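(* Let $\boldsymbol X=(X_1,\dots,X_n)$ be an i.i.d. sample from a density $p_\theta$, $\theta\in\Theta\subseteq\mathbb R$. If $\theta$ is a location or a scale parameter, then the fiducial distribution for $\theta$ coincides with the Bayesian posterior obtained with the Jeffreys prior $\pi^J(\theta)\propto1$ or $\pi^J(\theta)\propto1/\theta$, respectively.
   Context: $\theta$ is a location parameter if $p_\theta(x)=f(x-\theta)$, with $\Theta=\mathbb R$, and a scale parameter if $p_\theta(x)=f(x/\theta)/\theta$, with $\Theta=(0,\infty)$, for a fixed density $f$ on $\mathbb R$. The ancillary statistic is $\boldsymbol Z=(Z_2,\dots,Z_n)$ with $Z_i=X_i-X_1$ in the location case and $Z_i=X_i/X_1$ in the scale case. The fiducial distribution of $\theta$ given $\boldsymbol X=\boldsymbol x$ is the distribution with density $$h_{\boldsymbol x}(\theta)=\left|\frac{\partial}{\partial\theta}F_\theta(x_1\mid\boldsymbol z)\right|,$$ where $F_\theta(x_1\mid\boldsymbol z)$ is the conditional distribution function of $X_1$ given $\boldsymbol Z=\boldsymbol z$. Standing assumption: $F_\theta(x_1\mid\boldsymbol z)$ is monotone and differentiable in $\theta$, with limits $0$ and $1$ (in some order) as $\theta$ tends to the boundaries of $\Theta$. The posterior obtained with a (possibly improper) prior $\pi$ has density proportional to $\pi(\theta)\prod_{i=1}^n p_\theta(x_i)$. *)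

theory Defs
  imports "HOL-Probability.Probability"
begin

definition probability_density :: "(real \<Rightarrow> real) \<Rightarrow> bool" where
  "probability_density f \<longleftrightarrow>
     f \<in> borel_measurable borel \<and> (\<forall>x. 0 \<le> f x) \<and> (\<integral>\<^sup>+x. ennreal (f x) \<partial>lborel) = 1"

definition location_family :: "(real \<Rightarrow> real) \<Rightarrow> real \<Rightarrow> real \<Rightarrow> real" where
  "location_family f \<theta> x = f (x - \<theta>)"

definition scale_family :: "(real \<Rightarrow> real) \<Rightarrow> real \<Rightarrow> real \<Rightarrow> real" where
  "scale_family f \<theta> x = f (x / \<theta>) / \<theta>"

definition location_ancillary :: "nat \<Rightarrow> (nat \<Rightarrow> real) \<Rightarrow> nat \<Rightarrow> real" where
  "location_ancillary n x = (\<lambda>i\<in>{2..n}. x i - x 1)"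

definition scale_ancillary :: "nat \<Rightarrow> (nat \<Rightarrow> real) \<Rightarrow> nat \<Rightarrow> real" where
  "scale_ancillary n x = (\<lambda>i\<in>{2..n}. x i / x 1)"

(* K is a version of the regular conditional distribution of the real random variable U
   given V.  The conditional distribution function of U given V = z is cdf (K z). *)
definition regular_conditional_distribution ::
    "'w measure \<Rightarrow> ('w \<Rightarrow> real) \<Rightarrow> 'z measure \<Rightarrow> ('w \<Rightarrow> 'z) \<Rightarrow> ('z \<Rightarrow> real measure) \<Rightarrow> bool" where
  "regular_conditional_distribution M U N V K \<longleftrightarrow>
     U \<in> borel_measurable M \<and> V \<in> measurable M N \<and> K \<in> measurable N (prob_algebra borel) \<and>
     (\<forall>A\<in>sets borel. \<forall>B\<in>sets N.
        emeasure M {w \<in> space M. U w \<in> A \<and> V w \<in> B} =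
        (\<integral>\<^sup>+z. emeasure (K z) A * indicator B z \<partial>distr M N V))"

(* The filter lo describes approaching the lower boundary of the parameter space; the
   upper boundary is always +infinity. *)
definition admissible_in_parameter :: "real set \<Rightarrow> real filter \<Rightarrow> (real \<Rightarrow> real) \<Rightarrow> bool" where
  "admissible_in_parameter \<Theta> lo G \<longleftrightarrow>
     (mono_on \<Theta> G \<or> antimono_on \<Theta> G) \<and>
     (\<forall>\<theta>\<in>\<Theta>. G differentiable (at \<theta>)) \<and>
     ((G \<longlongrightarrow> 0) lo \<and> (G \<longlongrightarrow> 1) at_top \<or> (G \<longlongrightarrow> 1) lo \<and> (G \<longlongrightarrow> 0) at_top)"

(* Conditional distributions are determined only up to null sets of z, and F_theta(x_1 | z)
   can have limits 0 and 1 in theta only for x in the range of the sample (e.g. x_1 > 0 for a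
   scale parameter with f concentrated on the positive half-line).  Therefore the assumption
   "admissible" is required almost surely in the sample; for each such sample it concerns
   the function of theta on all of the parameter space. *)
locale fiducial_model =
  fixes \<Theta> :: "real set" and lo :: "real filter"
    and p :: "real \<Rightarrow> real \<Rightarrow> real"
    and n :: nat
    and Z :: "(nat \<Rightarrow> real) \<Rightarrow> nat \<Rightarrow> real"
    and P :: "real \<Rightarrow> 'w measure"
    and X :: "nat \<Rightarrow> 'w \<Rightarrow> real"
    and K :: "real \<Rightarrow> (nat \<Rightarrow> real) \<Rightarrow> real measure"
  assumes sample_size: "1 \<le> n"
    and prob_space_P: "\<And>\<theta>. \<theta> \<in> \<Theta> \<Longrightarrow> prob_space (P \<theta>)"
    and independent: "\<And>\<theta>. \<theta> \<in> \<Theta> \<Longrightarrow> prob_space.indep_vars (P \<theta>) (\<lambda>_. borel) X {1..n}"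
    and identically_distributed:
      "\<And>\<theta> i. \<theta> \<in> \<Theta> \<Longrightarrow> i \<in> {1..n} \<Longrightarrow> distributed (P \<theta>) lborel (X i) (\<lambda>x. ennreal (p \<theta> x))"
    and conditional:
      "\<And>\<theta>. \<theta> \<in> \<Theta> \<Longrightarrow>
        regular_conditional_distribution (P \<theta>) (X 1) (PiM {2..n} (\<lambda>_. borel))
          (\<lambda>w. Z (\<lambda>i. X i w)) (K \<theta>)"
    and admissible:
      "\<And>\<theta>\<^sub>0. \<theta>\<^sub>0 \<in> \<Theta> \<Longrightarrow>
        AE w in P \<theta>\<^sub>0. admissible_in_parameter \<Theta> lo (\<lambda>\<theta>. cdf (K \<theta> (Z (\<lambda>i. X i w))) (X 1 w))"

definition fiducial_distribution ::
    "real set \<Rightarrow> ((nat \<Rightarrow> real) \<Rightarrow> nat \<Rightarrow> real) \<Rightarrow> (real \<Rightarrow> (nat \<Rightarrow> real) \<Rightarrow> real measure)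
      \<Rightarrow> (nat \<Rightarrow> real) \<Rightarrow> real measure" where
  "fiducial_distribution \<Theta> Z K x =
     density lborel (\<lambda>\<theta>. ennreal \<bar>deriv (\<lambda>t. cdf (K t (Z x)) (x 1)) \<theta>\<bar> * indicator \<Theta> \<theta>)"

(* The prior may be improper; Q being a probability measure determines the constant c and
   says that the posterior is proper. *)
definition is_posterior ::
    "real set \<Rightarrow> (real \<Rightarrow> real) \<Rightarrow> (real \<Rightarrow> real \<Rightarrow> real) \<Rightarrow> nat \<Rightarrow> (nat \<Rightarrow> real) \<Rightarrow> real measure \<Rightarrow> bool" where
  "is_posterior \<Theta> \<pi> p n x Q \<longleftrightarrow>
     prob_space Q \<and>
     (\<exists>c>0. Q = density lborel (\<lambda>\<theta>. ennreal (c * (\<pi> \<theta> * (\<Prod>i=1..n. p \<theta> (x i)))) * indicator \<Theta> \<theta>))"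

definition proportional_on :: "real set \<Rightarrow> (real \<Rightarrow> real) \<Rightarrow> (real \<Rightarrow> real) \<Rightarrow> bool" where
  "proportional_on \<Theta> g h \<longleftrightarrow> (\<exists>c>0. \<forall>\<theta>\<in>\<Theta>. g \<theta> = c * h \<theta>)"

definition fisher_information :: "(real \<Rightarrow> real \<Rightarrow> real) \<Rightarrow> real \<Rightarrow> real" where
  "fisher_information p \<theta> = (\<integral>x. (deriv (\<lambda>t. ln (p t x)) \<theta>)\<^sup>2 * p \<theta> x \<partial>lborel)"

definition has_fisher_information :: "real set \<Rightarrow> (real \<Rightarrow> real \<Rightarrow> real) \<Rightarrow> bool" where
  "has_fisher_information \<Theta> p \<longleftrightarrow>
     (\<forall>\<theta>\<in>\<Theta>. (AE x in density lborel (\<lambda>x. ennreal (p \<theta> x)). (\<lambda>t. p t x) differentiable (at \<theta>)) \<and>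
        integrable lborel (\<lambda>x. (deriv (\<lambda>t. ln (p t x)) \<theta>)\<^sup>2 * p \<theta> x) \<and>
        0 < fisher_information p \<theta>)"

definition jeffreys_prior :: "(real \<Rightarrow> real \<Rightarrow> real) \<Rightarrow> real \<Rightarrow> real" where
  "jeffreys_prior p \<theta> = sqrt (fisher_information p \<theta>)"

end

theory Submission
  imports Defs
begin

text \<open>
  Both families arise from one density by affine maps: under \<open>\<theta>\<close> an observation is distributed as
  \<open>m \<theta> + s \<theta> * V\<close> with \<open>V\<close> of density \<open>f\<close>. In both cases the ancillary statistic consists
  of residuals \<open>(X i - a (X 1)) / b (X 1)\<close> with \<open>a\<close> and \<open>b\<close> equivariant
  (\<open>a u = u\<close>, \<open>b u = 1\<close> for location; \<open>a u = 0\<close>, \<open>b u = u\<close> for scale), so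
  the residuals are functions of the \<open>V\<close>'s alone. The locale \<open>affine_fiducial_model\<close>
  treats both cases at once.

  Let \<open>q z u\<close> be the joint density of the first observation and the residuals under \<open>f\<close>
  (\<open>standard_density\<close>) and \<open>C z\<close> its integral over \<open>u\<close>. Substitution shows that under every
  \<open>\<theta>\<close> the residuals have density \<open>C\<close>, and that given the residuals \<open>z\<close>
  the conditional distribution function of \<open>X 1\<close> at \<open>x\<close> is \<open>G z (\<phi> \<theta>)\<close>,
  where \<open>\<phi> \<theta> = (x - m \<theta>) / s \<theta>\<close> and \<open>G z\<close> has density \<open>q z / C z\<close>
  (\<open>conditional_cdf_eq_AE\<close>). The chain rule then suggests the fiducial density
  \<open>q z (\<phi> \<theta>) / C z * |\<phi>' \<theta>|\<close>. Here \<open>q z (\<phi> \<theta>) / s \<theta>\<close> is the joint density under \<open>\<theta>\<close>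
  at the observed \<open>x\<close>, which is the likelihood times a power of \<open>|b x|\<close>, and
  \<open>|\<phi>' \<theta>| = |b x| * j \<theta> / s \<theta>\<close>, with \<open>j\<close> the Jeffreys prior, \<open>1\<close> or
  \<open>1 / \<theta>\<close>. The factors \<open>s \<theta>\<close> cancel and leave likelihood times \<open>j\<close>, up to a factor free of
  \<open>\<theta>\<close>.

  Two points need care. The density \<open>f\<close> need not be continuous, so the chain rule is available only
  almost everywhere: both sides have the same integral over every compact interval of parameters, namely
  the increment of the distribution function, and therefore agree as densities
  (\<open>density_abs_deriv_eq\<close>). And for each \<open>\<theta>\<close> the conditional law is
  determined only up to a null set, so the formula for it is first obtained for rational \<open>\<theta>\<close> outside one
  null set; for other \<open>\<theta>\<close> it follows because the conditional distribution function is assumed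
  differentiable, hence continuous, in \<open>\<theta>\<close> (\<open>fiducial_is_posterior_if_regular\<close>).

  That \<open>j\<close> is the Jeffreys prior is a substitution in the Fisher information
  (\<open>fisher_information_location\<close>, \<open>fisher_information_scale\<close>).
\<close>

section \<open>The joint law of the first observation and the ancillary statistic\<close>

lemma PiM_density:
  fixes g :: "real \<Rightarrow> ennreal"
  assumes I: "finite I" and g[measurable]: "g \<in> borel_measurable borel"
    and prob: "prob_space (density lborel g)"
  shows "PiM I (\<lambda>_. density lborel g) = density (PiM I (\<lambda>_. lborel)) (\<lambda>y. \<Prod>i\<in>I. g (y i))"
proof -
  interpret D: prob_space "density lborel g" by (rule prob)
  interpret D: product_sigma_finite "\<lambda>_. density lborel g"
    by (simp add: product_sigma_finite_def D.sigma_finite_measure_axioms)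
  interpret L: product_sigma_finite "\<lambda>_::'a. lborel :: real measure"
    by (simp add: product_sigma_finite_def lborel.sigma_finite_measure_axioms)
  have "density (PiM I (\<lambda>_. lborel)) (\<lambda>y. \<Prod>i\<in>I. g (y i)) = PiM I (\<lambda>_. density lborel g)"
  proof (rule D.PiM_eqI[OF I])
    show "sets (density (PiM I (\<lambda>_. lborel)) (\<lambda>y. \<Prod>i\<in>I. g (y i)))
        = sets (PiM I (\<lambda>_. density lborel g))"
      unfolding sets_density by (intro sets_PiM_cong) auto
  next
    fix A assume A: "\<And>i. i \<in> I \<Longrightarrow> A i \<in> sets (density lborel g)"
    then have A': "\<And>i. i \<in> I \<Longrightarrow> A i \<in> sets lborel" by simp
    have PA: "Pi\<^sub>E I A \<in> sets (PiM I (\<lambda>_. lborel))"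
      by (rule sets_PiM_I_finite[OF I A'])
    have "emeasure (density (PiM I (\<lambda>_. lborel)) (\<lambda>y. \<Prod>i\<in>I. g (y i))) (Pi\<^sub>E I A)
        = (\<integral>\<^sup>+y. (\<Prod>i\<in>I. g (y i)) * indicator (Pi\<^sub>E I A) y \<partial>PiM I (\<lambda>_. lborel))"
      using PA by (intro emeasure_density) auto
    also have "\<dots> = (\<integral>\<^sup>+y. (\<Prod>i\<in>I. g (y i) * indicator (A i) (y i)) \<partial>PiM I (\<lambda>_. lborel))"
    proof (rule nn_integral_cong)
      fix y :: "'a \<Rightarrow> real" assume "y \<in> space (PiM I (\<lambda>_. lborel))"
      then have "y \<in> extensional I" by (auto simp: space_PiM PiE_def)
      then have "indicator (Pi\<^sub>E I A) y = (\<Prod>i\<in>I. indicator (A i) (y i) :: ennreal)"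
        using I by (auto simp: indicator_def PiE_def prod_zero_iff Pi_def split: if_splits
            intro!: prod.neutral[symmetric])
      then show "(\<Prod>i\<in>I. g (y i)) * indicator (Pi\<^sub>E I A) y
          = (\<Prod>i\<in>I. g (y i) * indicator (A i) (y i))"
        by (simp add: prod.distrib)
    qed
    also have "\<dots> = (\<Prod>i\<in>I. \<integral>\<^sup>+y. g y * indicator (A i) y \<partial>lborel)"
      using A' I by (intro L.product_nn_integral_prod) auto
    also have "\<dots> = (\<Prod>i\<in>I. emeasure (density lborel g) (A i))"
      using A' by (intro prod.cong refl emeasure_density[symmetric]) auto
    finally show "emeasure (density (PiM I (\<lambda>_. lborel)) (\<lambda>y. \<Prod>i\<in>I. g (y i))) (Pi\<^sub>E I A)
        = (\<Prod>i\<in>I. emeasure (density lborel g) (A i))" .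
  qed
  then show ?thesis by simp
qed

lemma distr_density_affine:
  fixes g :: "real \<Rightarrow> ennreal"
  assumes g[measurable]: "g \<in> borel_measurable borel" and c: "c \<noteq> 0"
  shows "distr (density lborel g) borel (\<lambda>y. (y - t) / c)
    = density lborel (\<lambda>z. ennreal \<bar>c\<bar> * g (t + c * z))"
proof (rule measure_eqI)
  fix A :: "real set" assume "A \<in> sets (distr (density lborel g) borel (\<lambda>y. (y - t) / c))"
  then have [measurable]: "A \<in> sets borel" by simp
  have [measurable]: "(\<lambda>y. (y - t) / c) -` A \<in> sets borel"
    by (rule measurable_sets_borel[of _ borel]) auto
  have "emeasure (distr (density lborel g) borel (\<lambda>y. (y - t) / c)) A
      = emeasure (density lborel g) ((\<lambda>y. (y - t) / c) -` A)"
    by (subst emeasure_distr) auto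
  also have "\<dots> = (\<integral>\<^sup>+y. g y * indicator A ((y - t) / c) \<partial>lborel)"
    by (subst emeasure_density) (auto intro!: nn_integral_cong simp: indicator_def)
  also have "\<dots> = ennreal \<bar>c\<bar> * (\<integral>\<^sup>+z. g (t + c * z) * indicator A ((t + c * z - t) / c) \<partial>lborel)"
    by (rule nn_integral_real_affine[OF _ c]) simp
  also have "\<dots> = (\<integral>\<^sup>+z. ennreal \<bar>c\<bar> * (g (t + c * z) * indicator A z) \<partial>lborel)"
    using c by (subst nn_integral_cmult[symmetric]) auto
  also have "\<dots> = emeasure (density lborel (\<lambda>z. ennreal \<bar>c\<bar> * g (t + c * z))) A"
    by (subst emeasure_density) (auto simp: mult.assoc)
  finally show "emeasure (distr (density lborel g) borel (\<lambda>y. (y - t) / c)) A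
      = emeasure (density lborel (\<lambda>z. ennreal \<bar>c\<bar> * g (t + c * z))) A" .
qed simp

lemma distr_PiM_affine:
  fixes g :: "real \<Rightarrow> ennreal"
  assumes I: "finite I" and g[measurable]: "g \<in> borel_measurable borel"
    and prob: "prob_space (density lborel g)" and c: "c \<noteq> 0"
  shows "distr (PiM I (\<lambda>_. density lborel g)) (PiM I (\<lambda>_. borel)) (\<lambda>y. \<lambda>i\<in>I. (y i - t) / c)
    = density (PiM I (\<lambda>_. lborel)) (\<lambda>z. \<Prod>i\<in>I. ennreal \<bar>c\<bar> * g (t + c * z i))"
proof -
  have prob': "prob_space (density lborel (\<lambda>z. ennreal \<bar>c\<bar> * g (t + c * z)))"
    unfolding distr_density_affine[OF g c, symmetric]
    by (rule prob_space.prob_space_distr[OF prob]) simp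
  \<comment> \<open>The image theorem for product measures asks for probability measures as targets, which
    \<open>borel\<close> is not; \<open>return borel 0\<close> has the same sets.\<close>
  let ?R = "\<lambda>_::'a. return borel (0::real)"
  have "distr (PiM I (\<lambda>_. density lborel g)) (PiM I (\<lambda>_. borel)) (compose I (\<lambda>y. (y - t) / c))
      = distr (PiM I (\<lambda>_. density lborel g)) (PiM I ?R) (compose I (\<lambda>y. (y - t) / c))"
    by (intro distr_cong sets_PiM_cong) auto
  also have "\<dots> = PiM I (\<lambda>_. distr (density lborel g) (return borel 0) (\<lambda>y. (y - t) / c))"
    by (rule distr_PiM_finite_prob_space'[OF I]) (simp_all add: prob prob_space_return)
  also have "\<dots> = PiM I (\<lambda>_. distr (density lborel g) borel (\<lambda>y. (y - t) / c))"
    by (intro PiM_cong distr_cong) auto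
  finally have "distr (PiM I (\<lambda>_. density lborel g)) (PiM I (\<lambda>_. borel)) (compose I (\<lambda>y. (y - t) / c))
      = PiM I (\<lambda>_. distr (density lborel g) borel (\<lambda>y. (y - t) / c))" .
  moreover have "compose I (\<lambda>y. (y - t) / c) = (\<lambda>y. \<lambda>i\<in>I. (y i - t) / c)"
    by (simp add: compose_def fun_eq_iff)
  ultimately show ?thesis
    unfolding distr_density_affine[OF g c]
    by (simp add: PiM_density[OF I _ prob'])
qed

text \<open>Given \<open>X 1 = u\<close>, the residuals \<open>(X i - a u) / b u\<close> are independent with
  density \<open>z \<mapsto> |b u| * g (a u + b u * z)\<close>; Tonelli's theorem then puts the integration over the
  residuals outside.\<close>

lemma joint_law_first_and_residuals:
  fixes g :: "real \<Rightarrow> ennreal" and X :: "nat \<Rightarrow> 'w \<Rightarrow> real" and a b :: "real \<Rightarrow> real"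
  assumes M: "prob_space M" and n: "1 \<le> n"
    and indep: "prob_space.indep_vars M (\<lambda>_. borel) X {1..n}"
    and X: "\<And>i. i \<in> {1..n} \<Longrightarrow> distributed M lborel (X i) g"
    and a[measurable]: "a \<in> borel_measurable borel" and b[measurable]: "b \<in> borel_measurable borel"
    and b0: "AE u in lborel. b u \<noteq> 0"
    and A[measurable]: "A \<in> sets borel" and B[measurable]: "B \<in> sets (PiM {2..n} (\<lambda>_. borel))"
  shows "emeasure M {w\<in>space M. X 1 w \<in> A \<and> (\<lambda>i\<in>{2..n}. (X i w - a (X 1 w)) / b (X 1 w)) \<in> B}
    = (\<integral>\<^sup>+z. (\<integral>\<^sup>+u. g u * (\<Prod>i\<in>{2..n}. ennreal \<bar>b u\<bar> * g (a u + b u * z i)) * indicator A u \<partial>lborel)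
        * indicator B z \<partial>PiM {2..n} (\<lambda>_. lborel))"
proof -
  interpret M: prob_space M by (rule M)
  have g[measurable]: "g \<in> borel_measurable borel"
    using distributed_borel_measurable[OF X[of 1]] n by simp
  have dX: "density lborel g = distr M borel (X i)" if "i \<in> {1..n}" for i
    using distributed_distr_eq_density[OF X[OF that]] by (simp cong: distr_cong)
  have X_meas: "X i \<in> borel_measurable M" if "i \<in> {1..n}" for i
    using distributed_measurable[OF X[OF that]] by simp
  have prob: "prob_space (density lborel g)"
    unfolding dX[of 1] using n by (subst dX[of 1]) (auto intro!: M.prob_space_distr X_meas)
  interpret D: prob_space "density lborel g" by (rule prob)
  interpret D: product_sigma_finite "\<lambda>_::nat. density lborel g"
    by (simp add: product_sigma_finite_def D.sigma_finite_measure_axioms)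
  interpret L: product_sigma_finite "\<lambda>_::nat. lborel :: real measure"
    by (simp add: product_sigma_finite_def lborel.sigma_finite_measure_axioms)
  interpret DI: finite_product_sigma_finite "\<lambda>_::nat. density lborel g" "{2..n}"
    by standard simp
  interpret LI: finite_product_sigma_finite "\<lambda>_::nat. lborel :: real measure" "{2..n}"
    by standard simp
  interpret LP: pair_sigma_finite "lborel :: real measure" "PiM {2..n} (\<lambda>_::nat. lborel :: real measure)"
    by standard
  have setsL: "sets (PiM {2..n} (\<lambda>_. lborel :: real measure)) = sets (PiM {2..n} (\<lambda>_. borel))"
    by (intro sets_PiM_cong) auto
  have setsD: "sets (PiM J (\<lambda>_. density lborel g)) = sets (PiM J (\<lambda>_. borel))" for J :: "nat set"
    by (intro sets_PiM_cong) auto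
  let ?P = "PiM {2..n} (\<lambda>_::nat. density lborel g)"
  let ?T = "\<lambda>u y. \<lambda>i\<in>{2..n}. (y i - a u) / b u"
  let ?S = "{y \<in> space (PiM {1..n} (\<lambda>_. borel)). y 1 \<in> A \<and> ?T (y 1) y \<in> B}"
  have m1: "(\<lambda>y. y 1) \<in> borel_measurable (PiM {1..n} (\<lambda>_. borel :: real measure))"
    using n by (intro measurable_component_singleton) auto
  have mi: "(\<lambda>y. y i) \<in> borel_measurable (PiM {1..n} (\<lambda>_. borel :: real measure))" if "i \<in> {2..n}" for i
    using that by (intro measurable_component_singleton) auto
  have mT: "(\<lambda>y. ?T (y 1) y) \<in> measurable (PiM {1..n} (\<lambda>_. borel)) (PiM {2..n} (\<lambda>_. borel))"
    by (intro measurable_restrict borel_measurable_divide borel_measurable_diff mi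
        measurable_compose[OF m1 a] measurable_compose[OF m1 b])
  have S: "?S \<in> sets (PiM {1..n} (\<lambda>_. borel))"
  proof -
    have "?S = ((\<lambda>y. y 1) -` A \<inter> space (PiM {1..n} (\<lambda>_. borel)))
        \<inter> ((\<lambda>y. ?T (y 1) y) -` B \<inter> space (PiM {1..n} (\<lambda>_. borel)))"
      by blast
    then show ?thesis
      using measurable_sets[OF m1 A] measurable_sets[OF mT B] by (simp only: sets.Int)
  qed
  have mF: "(indicator {y. y 1 \<in> A \<and> ?T (y 1) y \<in> B} :: _ \<Rightarrow> ennreal)
      \<in> borel_measurable (PiM (insert 1 {2..n}) (\<lambda>_. density lborel g))"
  proof -
    have "insert 1 {2..n} = {1..n}" using n by auto
    have "(indicator ?S :: _ \<Rightarrow> ennreal) \<in> borel_measurable (PiM {1..n} (\<lambda>_. density lborel g))"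
      using S by (intro borel_measurable_indicator) (simp add: setsD)
    then show ?thesis
      unfolding \<open>insert 1 {2..n} = {1..n}\<close>
      by (rule measurable_cong[THEN iffD1, rotated]) (auto simp: indicator_def space_PiM)
  qed
  have "emeasure M {w\<in>space M. X 1 w \<in> A \<and> (\<lambda>i\<in>{2..n}. (X i w - a (X 1 w)) / b (X 1 w)) \<in> B}
      = emeasure (distr M (PiM {1..n} (\<lambda>_. borel)) (\<lambda>w. \<lambda>i\<in>{1..n}. X i w)) ?S"
  proof (subst emeasure_distr[OF _ S])
    show "(\<lambda>w. \<lambda>i\<in>{1..n}. X i w) \<in> measurable M (PiM {1..n} (\<lambda>_. borel))"
      by (intro measurable_restrict X_meas)
    show "emeasure M {w\<in>space M. X 1 w \<in> A \<and> (\<lambda>i\<in>{2..n}. (X i w - a (X 1 w)) / b (X 1 w)) \<in> B}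
      = emeasure M ((\<lambda>w. \<lambda>i\<in>{1..n}. X i w) -` ?S \<inter> space M)"
    proof (rule arg_cong[where f="emeasure M"])
      have "(\<lambda>i\<in>{2..n}. ((\<lambda>i\<in>{1..n}. X i w) i - a (X 1 w)) / b (X 1 w))
         = (\<lambda>i\<in>{2..n}. (X i w - a (X 1 w)) / b (X 1 w))" for w
        by (auto simp: restrict_def)
      then show "{w\<in>space M. X 1 w \<in> A \<and> (\<lambda>i\<in>{2..n}. (X i w - a (X 1 w)) / b (X 1 w)) \<in> B}
        = (\<lambda>w. \<lambda>i\<in>{1..n}. X i w) -` ?S \<inter> space M"
        using n by (auto simp: space_PiM)
    qed
  qed
  also have "distr M (PiM {1..n} (\<lambda>_. borel)) (\<lambda>w. \<lambda>i\<in>{1..n}. X i w)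
      = PiM {1..n} (\<lambda>i. distr M borel (X i))"
    using M.indep_vars_iff_distr_eq_PiM'[of "{1..n}" X "\<lambda>_. borel"] indep n X_meas by auto
  also have "\<dots> = PiM {1..n} (\<lambda>_. density lborel g)"
    by (intro PiM_cong refl dX[symmetric])
  also have "{1..n} = insert 1 {2..n}" using n by auto
  also have "emeasure (PiM (insert 1 {2..n}) (\<lambda>_. density lborel g)) 
       {y \<in> space (PiM (insert 1 {2..n}) (\<lambda>_. borel)). y 1 \<in> A \<and> ?T (y 1) y \<in> B}
      = (\<integral>\<^sup>+y. indicator {y. y 1 \<in> A \<and> ?T (y 1) y \<in> B} y \<partial>PiM (insert 1 {2..n}) (\<lambda>_. density lborel g))"
  proof -
    have "insert 1 {2..n} = {1..n}" using n by auto
    then have "{y \<in> space (PiM (insert 1 {2..n}) (\<lambda>_. borel)). y 1 \<in> A \<and> ?T (y 1) y \<in> B}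
        \<in> sets (PiM (insert 1 {2..n}) (\<lambda>_. density lborel g))"
      using S setsD by simp
    note nn_integral_indicator[OF this, symmetric]
    also have "(\<integral>\<^sup>+y. indicator {y \<in> space (PiM (insert 1 {2..n}) (\<lambda>_. borel)). y 1 \<in> A \<and> ?T (y 1) y \<in> B} y
        \<partial>PiM (insert 1 {2..n}) (\<lambda>_. density lborel g))
      = (\<integral>\<^sup>+y. indicator {y. y 1 \<in> A \<and> ?T (y 1) y \<in> B} y \<partial>PiM (insert 1 {2..n}) (\<lambda>_. density lborel g))"
      by (intro nn_integral_cong) (auto simp: indicator_def space_PiM)
    finally show ?thesis .
  qed
  also have "\<dots> = (\<integral>\<^sup>+u. (\<integral>\<^sup>+y. indicator {y. y 1 \<in> A \<and> ?T (y 1) y \<in> B} (y(1 := u)) \<partial>?P) \<partial>density lborel g)"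
    by (rule D.product_nn_integral_insert_rev[OF _ _ mF]) auto
  also have "\<dots> = (\<integral>\<^sup>+u. g u * (\<integral>\<^sup>+y. indicator {y. y 1 \<in> A \<and> ?T (y 1) y \<in> B} (y(1 := u)) \<partial>?P) \<partial>lborel)"
  proof (rule nn_integral_density)
    show "g \<in> borel_measurable lborel" by simp
    have "(\<lambda>(u, y). y(1 := u)) \<in> measurable (density lborel g \<Otimes>\<^sub>M ?P)
        (PiM (insert 1 {2..n}) (\<lambda>_. density lborel g))"
      by (subst measurable_pair_swap_iff) (simp add: measurable_add_dim case_prod_unfold)
    then have "(\<lambda>(u, y). indicator {y. y 1 \<in> A \<and> ?T (y 1) y \<in> B} (y(1 := u)) :: ennreal)
        \<in> borel_measurable (density lborel g \<Otimes>\<^sub>M ?P)"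
      using measurable_compose[OF _ mF] by (simp add: case_prod_unfold)
    then have "(\<lambda>u. \<integral>\<^sup>+y. indicator {y. y 1 \<in> A \<and> ?T (y 1) y \<in> B} (y(1 := u)) \<partial>?P)
        \<in> borel_measurable (density lborel g)"
      by (rule DI.borel_measurable_nn_integral)
    then show "(\<lambda>u. \<integral>\<^sup>+y. indicator {y. y 1 \<in> A \<and> ?T (y 1) y \<in> B} (y(1 := u)) \<partial>?P)
        \<in> borel_measurable lborel"
      by simp
  qed
  also have "\<dots> = (\<integral>\<^sup>+u. (\<integral>\<^sup>+z. g u * (\<Prod>i\<in>{2..n}. ennreal \<bar>b u\<bar> * g (a u + b u * z i)) * indicator A u
      * indicator B z \<partial>PiM {2..n} (\<lambda>_. lborel)) \<partial>lborel)"
  proof (rule nn_integral_cong_AE)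
    show "AE u in lborel. g u * (\<integral>\<^sup>+y. indicator {y. y 1 \<in> A \<and> ?T (y 1) y \<in> B} (y(1 := u)) \<partial>?P)
      = (\<integral>\<^sup>+z. g u * (\<Prod>i\<in>{2..n}. ennreal \<bar>b u\<bar> * g (a u + b u * z i)) * indicator A u
        * indicator B z \<partial>PiM {2..n} (\<lambda>_. lborel))"
      using b0
    proof eventually_elim
      fix u assume bu: "b u \<noteq> 0"
      have mTu: "?T u \<in> measurable ?P (PiM {2..n} (\<lambda>_. borel))"
        by (intro measurable_restrict borel_measurable_divide borel_measurable_diff 
          measurable_component_singleton[THEN measurable_compose] measurable_const) auto
      have eq: "(\<lambda>i\<in>{2..n}. ((y(1 := u)) i - a u) / b u) = ?T u y" for y :: "nat \<Rightarrow> real"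
        by (auto simp: restrict_def)
      have "(\<integral>\<^sup>+y. indicator {y. y 1 \<in> A \<and> ?T (y 1) y \<in> B} (y(1 := u)) \<partial>?P)
          = (\<integral>\<^sup>+y. indicator A u * indicator B (?T u y) \<partial>?P)"
        by (intro nn_integral_cong) (simp only: indicator_def mem_Collect_eq fun_upd_same eq, simp)
      also have "\<dots> = (\<integral>\<^sup>+z. indicator A u * indicator B z \<partial>distr ?P (PiM {2..n} (\<lambda>_. borel)) (?T u))"
        by (rule nn_integral_distr[OF mTu, symmetric]) measurable
      also have "\<dots> = (\<integral>\<^sup>+z. (\<Prod>i\<in>{2..n}. ennreal \<bar>b u\<bar> * g (a u + b u * z i)) * (indicator A u * indicator B z)
          \<partial>PiM {2..n} (\<lambda>_. lborel))"
        unfolding distr_PiM_affine[OF finite_atLeastAtMost g prob bu]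
        using B setsL by (intro nn_integral_density) auto
      finally show "g u * (\<integral>\<^sup>+y. indicator {y. y 1 \<in> A \<and> ?T (y 1) y \<in> B} (y(1 := u)) \<partial>?P)
        = (\<integral>\<^sup>+z. g u * (\<Prod>i\<in>{2..n}. ennreal \<bar>b u\<bar> * g (a u + b u * z i)) * indicator A u
          * indicator B z \<partial>PiM {2..n} (\<lambda>_. lborel))"
        unfolding mult.assoc using B setsL by (simp only:) (subst nn_integral_cmult[symmetric], auto)
    qed
  qed
  also have "\<dots> = (\<integral>\<^sup>+z. (\<integral>\<^sup>+u. g u * (\<Prod>i\<in>{2..n}. ennreal \<bar>b u\<bar> * g (a u + b u * z i)) * indicator A u
      * indicator B z \<partial>lborel) \<partial>PiM {2..n} (\<lambda>_. lborel))"
    using B setsL by (intro LP.Fubini'[symmetric]) auto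
  also have "\<dots> = (\<integral>\<^sup>+z. (\<integral>\<^sup>+u. g u * (\<Prod>i\<in>{2..n}. ennreal \<bar>b u\<bar> * g (a u + b u * z i)) * indicator A u \<partial>lborel)
        * indicator B z \<partial>PiM {2..n} (\<lambda>_. lborel))"
    by (intro nn_integral_cong nn_integral_multc) (auto simp: space_PiM)
  finally show ?thesis .
qed

section \<open>Differentiating a distribution function along a change of variables\<close>

text \<open>The derivative is a limit of difference quotients. Outside \<open>\<Theta>\<close> nothing is known about
  \<open>H\<close>, not even measurability, so the quotients are formed with the globally measurable function
  \<open>H'\<close>.\<close>

lemma borel_measurable_deriv_indicator:
  fixes H H' :: "real \<Rightarrow> real"
  assumes [measurable]: "H' \<in> borel_measurable borel" and \<Theta>: "open \<Theta>"
    and eq: "\<And>\<theta>. \<theta> \<in> \<Theta> \<Longrightarrow> H \<theta> = H' \<theta>"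
    and diff: "\<And>\<theta>. \<theta> \<in> \<Theta> \<Longrightarrow> H differentiable (at \<theta>)"
  shows "(\<lambda>\<theta>. deriv H \<theta> * indicator \<Theta> \<theta>) \<in> borel_measurable borel"
proof (rule borel_measurable_LIMSEQ_real)
  have [measurable]: "\<Theta> \<in> sets borel" using \<Theta> by simp
  let ?r = "\<lambda>k::nat. inverse (real (Suc k))"
  show "(\<lambda>\<theta>. (H' (\<theta> + ?r k) - H' \<theta>) / ?r k * indicator \<Theta> \<theta>) \<in> borel_measurable borel" for k
    by measurable
  show "(\<lambda>k. (H' (\<theta> + ?r k) - H' \<theta>) / ?r k * indicator \<Theta> \<theta>)
      \<longlonglongrightarrow> deriv H \<theta> * indicator \<Theta> \<theta>" for \<theta>
  proof (cases "\<theta> \<in> \<Theta>")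
    case True
    have "DERIV H \<theta> :> deriv H \<theta>"
      using diff[OF True] by (simp add: DERIV_deriv_iff_real_differentiable)
    moreover have "eventually (\<lambda>t. H t = H' t) (nhds \<theta>)"
      using eventually_nhds_in_open[OF \<Theta> True] by eventually_elim (rule eq)
    ultimately have "DERIV H' \<theta> :> deriv H \<theta>"
      by (subst (asm) DERIV_cong_ev[OF refl _ refl])
    then have "((\<lambda>h. (H' (\<theta> + h) - H' \<theta>) / h) \<longlongrightarrow> deriv H \<theta>) (at 0)"
      by (simp add: DERIV_def)
    moreover have "filterlim ?r (at 0) sequentially"
      using LIMSEQ_inverse_real_of_nat by (auto simp: filterlim_at)
    ultimately have "(\<lambda>k. (H' (\<theta> + ?r k) - H' \<theta>) / ?r k) \<longlonglongrightarrow> deriv H \<theta>"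
      by (rule filterlim_compose)
    then show ?thesis using True by simp
  qed simp
qed

lemma nn_integral_abs_deriv_Icc:
  fixes H H' :: "real \<Rightarrow> real"
  assumes H': "H' \<in> borel_measurable borel" and \<Theta>: "open \<Theta>"
    and eq: "\<And>\<theta>. \<theta> \<in> \<Theta> \<Longrightarrow> H \<theta> = H' \<theta>"
    and diff: "\<And>\<theta>. \<theta> \<in> \<Theta> \<Longrightarrow> H differentiable (at \<theta>)"
    and mono: "mono_on \<Theta> H \<or> antimono_on \<Theta> H"
    and st: "s \<le> t" "{s..t} \<subseteq> \<Theta>"
  shows "(\<integral>\<^sup>+\<theta>. ennreal \<bar>deriv H \<theta>\<bar> * indicator {s..t} \<theta> \<partial>lborel) = ennreal \<bar>H t - H s\<bar>"
proof -
  define d where "d \<theta> = deriv H \<theta> * indicator \<Theta> \<theta>" for \<theta>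
  have d[measurable]: "d \<in> borel_measurable borel"
    unfolding d_def by (rule borel_measurable_deriv_indicator[OF H' \<Theta> eq diff])
  have D: "DERIV H \<theta> :> d \<theta>" if "\<theta> \<in> \<Theta>" for \<theta>
    using diff[OF that] that by (simp add: DERIV_deriv_iff_real_differentiable d_def)
  have "(\<integral>\<^sup>+\<theta>. ennreal \<bar>deriv H \<theta>\<bar> * indicator {s..t} \<theta> \<partial>lborel)
      = (\<integral>\<^sup>+\<theta>. ennreal \<bar>d \<theta>\<bar> * indicator {s..t} \<theta> \<partial>lborel)"
    using st by (intro nn_integral_cong) (auto simp: d_def indicator_def)
  also have "\<dots> = ennreal \<bar>H t - H s\<bar>"
    using mono
  proof
    assume m: "mono_on \<Theta> H"
    have nn: "0 \<le> d \<theta>" if "\<theta> \<in> \<Theta>" for \<theta>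
      using mono_on_imp_deriv_nonneg[OF m D[OF that]] that interior_open[OF \<Theta>] by simp
    have "(\<integral>\<^sup>+\<theta>. ennreal \<bar>d \<theta>\<bar> * indicator {s..t} \<theta> \<partial>lborel)
        = (\<integral>\<^sup>+\<theta>. ennreal (d \<theta>) * indicator {s..t} \<theta> \<partial>lborel)"
      using st nn by (intro nn_integral_cong) (auto simp: indicator_def)
    also have "\<dots> = ennreal (H t - H s)"
      using st nn D by (intro nn_integral_FTC_Icc) auto
    moreover have "H s \<le> H t" using st by (intro mono_onD[OF m]) auto
    ultimately show ?thesis by simp
  next
    assume m: "antimono_on \<Theta> H"
    then have m': "mono_on \<Theta> (\<lambda>\<theta>. - H \<theta>)" by (auto simp: monotone_on_def)
    have D': "DERIV (\<lambda>\<theta>. - H \<theta>) \<theta> :> - d \<theta>" if "\<theta> \<in> \<Theta>" for \<theta>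
      using D[OF that] by (rule DERIV_minus)
    have nn: "0 \<le> - d \<theta>" if "\<theta> \<in> \<Theta>" for \<theta>
      using mono_on_imp_deriv_nonneg[OF m' D'[OF that]] that interior_open[OF \<Theta>] by simp
    have "(\<integral>\<^sup>+\<theta>. ennreal \<bar>d \<theta>\<bar> * indicator {s..t} \<theta> \<partial>lborel)
        = (\<integral>\<^sup>+\<theta>. ennreal (- d \<theta>) * indicator {s..t} \<theta> \<partial>lborel)"
      using st abs_of_nonpos nn by (intro nn_integral_cong) (force simp: indicator_def subset_iff)
    also have "\<dots> = ennreal (- H t - - H s)"
      using st nn D' by (intro nn_integral_FTC_Icc) auto
    moreover have "H t \<le> H s" using mono_onD[OF m' _ _ st(1)] st by (simp add: subset_iff)
    ultimately show ?thesis by (simp add: abs_if)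
  qed
  finally show ?thesis .
qed

lemma nn_integral_density_Icc_eq_cdf_diff:
  fixes g :: "real \<Rightarrow> real"
  assumes [measurable]: "g \<in> borel_measurable borel" and prob: "prob_space (density lborel g)"
    and "a \<le> b"
  shows "(\<integral>\<^sup>+x. ennreal (g x) * indicator {a..b} x \<partial>lborel)
    = ennreal (cdf (density lborel g) b - cdf (density lborel g) a)"
proof -
  interpret D: prob_space "density lborel g" by (rule prob)
  interpret D: finite_borel_measure "density lborel g" by standard auto
  have "(\<integral>\<^sup>+x. ennreal (g x) * indicator {a..b} x \<partial>lborel)
      = (\<integral>\<^sup>+x. ennreal (g x) * indicator {a<..b} x \<partial>lborel)"
    using AE_lborel_singleton[of a]
    by (intro nn_integral_cong_AE, eventually_elim) (auto simp: indicator_def)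
  also have "\<dots> = emeasure (density lborel g) {a<..b}"
    by (subst emeasure_density) auto
  also have "\<dots> = ennreal (cdf (density lborel g) b - cdf (density lborel g) a)"
    using \<open>a \<le> b\<close> D.cdf_diff_eq[of a b] by (cases "a = b") (auto simp: D.emeasure_eq_measure)
  finally show ?thesis .
qed

lemma nn_integral_density_along_Icc:
  fixes g \<phi> \<phi>' :: "real \<Rightarrow> real"
  assumes g[measurable]: "g \<in> borel_measurable borel"
    and prob: "prob_space (density lborel g)"
    and D: "\<And>\<theta>. \<theta> \<in> {s..t} \<Longrightarrow> (\<phi> has_real_derivative \<phi>' \<theta>) (at \<theta>)"
    and cont: "continuous_on {s..t} \<phi>'"
    and sign: "(\<forall>\<theta>\<in>{s..t}. 0 \<le> \<phi>' \<theta>) \<or> (\<forall>\<theta>\<in>{s..t}. \<phi>' \<theta> \<le> 0)"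
    and st: "s \<le> t"
  shows "(\<integral>\<^sup>+\<theta>. ennreal (g (\<phi> \<theta>) * \<bar>\<phi>' \<theta>\<bar>) * indicator {s..t} \<theta> \<partial>lborel)
    = ennreal \<bar>cdf (density lborel g) (\<phi> t) - cdf (density lborel g) (\<phi> s)\<bar>"
  using sign
proof
  let ?F = "cdf (density lborel g)"
  interpret D: prob_space "density lborel g" by (rule prob)
  interpret D: finite_borel_measure "density lborel g" by standard auto
  assume nn: "\<forall>\<theta>\<in>{s..t}. 0 \<le> \<phi>' \<theta>"
  have le: "\<phi> s \<le> \<phi> t"
    by (rule DERIV_nonneg_imp_nondecreasing[OF st]) (meson D nn atLeastAtMost_iff)
  have "(\<integral>\<^sup>+\<theta>. ennreal (g (\<phi> \<theta>) * \<bar>\<phi>' \<theta>\<bar>) * indicator {s..t} \<theta> \<partial>lborel)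
      = (\<integral>\<^sup>+\<theta>. g (\<phi> \<theta>) * \<phi>' \<theta> * indicator {s..t} \<theta> \<partial>lborel)"
    using nn by (intro nn_integral_cong) (auto simp: indicator_def)
  also have "\<dots> = (\<integral>\<^sup>+x. g x * indicator {\<phi> s..\<phi> t} x \<partial>lborel)"
    by (rule nn_integral_substitution[symmetric, OF _ D cont _ st])
      (use nn in \<open>auto simp: set_borel_measurable_def\<close>)
  also have "\<dots> = (\<integral>\<^sup>+x. ennreal (g x) * indicator {\<phi> s..\<phi> t} x \<partial>lborel)"
    by (intro nn_integral_cong) (auto simp: indicator_def)
  also have "\<dots> = ennreal (?F (\<phi> t) - ?F (\<phi> s))"
    by (rule nn_integral_density_Icc_eq_cdf_diff[OF g prob le])
  finally show ?thesis using D.cdf_nondecreasing[OF le] by simp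
next
  let ?F = "cdf (density lborel g)"
  interpret D: prob_space "density lborel g" by (rule prob)
  interpret D: finite_borel_measure "density lborel g" by standard auto
  assume np: "\<forall>\<theta>\<in>{s..t}. \<phi>' \<theta> \<le> 0"
  have le: "\<phi> t \<le> \<phi> s"
    by (rule DERIV_nonpos_imp_nonincreasing[OF st]) (meson D np atLeastAtMost_iff)
  have "(\<integral>\<^sup>+\<theta>. ennreal (g (\<phi> \<theta>) * \<bar>\<phi>' \<theta>\<bar>) * indicator {s..t} \<theta> \<partial>lborel)
      = (\<integral>\<^sup>+\<theta>. g (- (- \<phi> \<theta>)) * - \<phi>' \<theta> * indicator {s..t} \<theta> \<partial>lborel)"
    using np by (intro nn_integral_cong) (auto simp: indicator_def)
  also have "\<dots> = (\<integral>\<^sup>+x. g (- x) * indicator {- \<phi> s..- \<phi> t} x \<partial>lborel)"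
    by (rule nn_integral_substitution[symmetric, where f="\<lambda>x. g (- x)",
        OF _ DERIV_minus[OF D] continuous_on_minus[OF cont] _ st])
      (use np in \<open>auto simp: set_borel_measurable_def\<close>)
  also have "\<dots> = (\<integral>\<^sup>+x. ennreal (g (0 + (-1) * x)) * indicator {\<phi> t..\<phi> s} (0 + (-1) * x) \<partial>lborel)"
    by (intro nn_integral_cong) (auto simp: indicator_def)
  also have "\<dots> = (\<integral>\<^sup>+x. ennreal (g x) * indicator {\<phi> t..\<phi> s} x \<partial>lborel)"
    by (subst (2) nn_integral_real_affine[where c="-1" and t=0]) auto
  also have "\<dots> = ennreal (?F (\<phi> s) - ?F (\<phi> t))"
    by (rule nn_integral_density_Icc_eq_cdf_diff[OF g prob le])
  finally show ?thesis using D.cdf_nondecreasing[OF le] by (simp add: abs_if)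
qed

lemma AE_eq_if_nn_integral_Icc_eq:
  fixes u w :: "real \<Rightarrow> ennreal"
  assumes [measurable]: "u \<in> borel_measurable borel" "w \<in> borel_measurable borel"
    and fin: "(\<integral>\<^sup>+x. u x * indicator {s..t} x \<partial>lborel) < \<infinity>"
    and eq: "\<And>y. s \<le> y \<Longrightarrow> y \<le> t \<Longrightarrow> (\<integral>\<^sup>+x. u x * indicator {y..t} x \<partial>lborel)
      = (\<integral>\<^sup>+x. w x * indicator {y..t} x \<partial>lborel)"
  shows "AE x in lborel. x \<in> {s..t} \<longrightarrow> u x = w x"
proof (cases "s \<le> t")
  case True
  let ?u = "\<lambda>x. u x * indicator {s..t} x" and ?w = "\<lambda>x. w x * indicator {s..t} x"
  have em: "emeasure (density lborel (\<lambda>x. v x * indicator {s..t} x)) {y<..}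
      = (if t < y then 0 else (\<integral>\<^sup>+x. v x * indicator {max s y..t} x \<partial>lborel))"
    if [measurable]: "v \<in> borel_measurable borel" for v :: "real \<Rightarrow> ennreal" and y
  proof -
    have "emeasure (density lborel (\<lambda>x. v x * indicator {s..t} x)) {y<..}
        = (\<integral>\<^sup>+x. v x * indicator {s..t} x * indicator {y<..} x \<partial>lborel)"
      by (subst emeasure_density) auto
    also have "\<dots> = (\<integral>\<^sup>+x. v x * indicator {max s y..t} x \<partial>lborel)"
      using AE_lborel_singleton[of y]
      by (intro nn_integral_cong_AE, eventually_elim) (auto simp: indicator_def)
    finally show ?thesis by auto
  qed
  have "density lborel ?u = density lborel ?w"
  proof (rule measure_eqI_lessThan)
    fix y :: real
    have "emeasure (density lborel ?u) {y<..} \<le> emeasure (density lborel ?u) UNIV"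
      by (rule emeasure_mono) auto
    also have "\<dots> = (\<integral>\<^sup>+x. u x * indicator {s..t} x \<partial>lborel)"
      by (subst emeasure_density) auto
    finally show "emeasure (density lborel ?u) {y<..} < \<infinity>"
      using fin by (rule le_less_trans)
    show "emeasure (density lborel ?u) {y<..} = emeasure (density lborel ?w) {y<..}"
      using eq[of "max s y"] True by (simp add: em)
  qed auto
  then have "AE x in lborel. ?u x = ?w x"
    by (intro sigma_finite_measure.density_unique[OF lborel.sigma_finite_measure_axioms]) auto
  then show ?thesis
    by eventually_elim (auto simp: indicator_def)
qed auto

text \<open>This replaces the chain rule \<open>|deriv H \<theta>| = g (\<phi> \<theta>) * |\<phi>' \<theta>|\<close>, which
  may fail where \<open>g\<close> is discontinuous. On each compact subinterval of \<open>\<Theta>\<close> both sides integrate to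
  the absolute increment of \<open>H\<close>, the left one by the fundamental theorem of calculus and the right one
  by substitution. The total mass is the limit of the increments along an exhaustion of \<open>\<Theta>\<close>.\<close>

lemma density_abs_deriv_eq:
  fixes g \<phi> \<phi>' H :: "real \<Rightarrow> real" and l h :: "nat \<Rightarrow> real"
  assumes g[measurable]: "g \<in> borel_measurable borel"
    and prob: "prob_space (density lborel g)"
    and \<Theta>: "open \<Theta>" and le: "\<And>k. l k \<le> h k"
    and inc: "incseq (\<lambda>k. {l k..h k})" and union: "(\<Union>k. {l k..h k}) = \<Theta>"
    and \<phi>[measurable]: "\<phi> \<in> borel_measurable borel"
    and D: "\<And>\<theta>. \<theta> \<in> \<Theta> \<Longrightarrow> (\<phi> has_real_derivative \<phi>' \<theta>) (at \<theta>)"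
    and cont: "continuous_on \<Theta> \<phi>'"
    and sign: "(\<forall>\<theta>\<in>\<Theta>. 0 \<le> \<phi>' \<theta>) \<or> (\<forall>\<theta>\<in>\<Theta>. \<phi>' \<theta> \<le> 0)"
    and H: "\<And>\<theta>. \<theta> \<in> \<Theta> \<Longrightarrow> H \<theta> = cdf (density lborel g) (\<phi> \<theta>)"
    and diff: "\<And>\<theta>. \<theta> \<in> \<Theta> \<Longrightarrow> H differentiable (at \<theta>)"
    and mono: "mono_on \<Theta> H \<or> antimono_on \<Theta> H"
    and lim: "(\<lambda>k. \<bar>H (h k) - H (l k)\<bar>) \<longlonglongrightarrow> 1"
  shows "density lborel (\<lambda>\<theta>. ennreal \<bar>deriv H \<theta>\<bar> * indicator \<Theta> \<theta>)
      = density lborel (\<lambda>\<theta>. ennreal (g (\<phi> \<theta>) * \<bar>\<phi>' \<theta>\<bar>) * indicator \<Theta> \<theta>)" (is "density _ ?u = density _ ?w")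
    and "prob_space (density lborel (\<lambda>\<theta>. ennreal \<bar>deriv H \<theta>\<bar> * indicator \<Theta> \<theta>))"
proof -
  interpret D: prob_space "density lborel g" by (rule prob)
  interpret D: finite_borel_measure "density lborel g" by standard auto
  let ?H' = "\<lambda>\<theta>. cdf (density lborel g) (\<phi> \<theta>)"
  have [measurable]: "cdf (density lborel g) \<in> borel_measurable borel"
    by (intro borel_measurable_mono monoI D.cdf_nondecreasing)
  have H'[measurable]: "?H' \<in> borel_measurable borel" by measurable
  have "(\<lambda>\<theta>. deriv H \<theta> * indicator \<Theta> \<theta>) \<in> borel_measurable borel"
    by (rule borel_measurable_deriv_indicator[OF H' \<Theta> H diff])
  then have "(\<lambda>\<theta>. ennreal \<bar>deriv H \<theta> * indicator \<Theta> \<theta>\<bar>) \<in> borel_measurable borel"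
    by measurable
  also have "(\<lambda>\<theta>. ennreal \<bar>deriv H \<theta> * indicator \<Theta> \<theta>\<bar>) = ?u"
    by (auto simp: indicator_def)
  finally have u[measurable]: "?u \<in> borel_measurable borel" .
  have "(\<lambda>\<theta>. indicator \<Theta> \<theta> *\<^sub>R \<phi>' \<theta>) \<in> borel_measurable borel"
    by (rule borel_measurable_continuous_on_indicator[OF _ cont]) (use \<Theta> in auto)
  then have "(\<lambda>\<theta>. ennreal (g (\<phi> \<theta>) * \<bar>indicator \<Theta> \<theta> *\<^sub>R \<phi>' \<theta>\<bar>)) \<in> borel_measurable borel"
    by measurable
  also have "(\<lambda>\<theta>. ennreal (g (\<phi> \<theta>) * \<bar>indicator \<Theta> \<theta> *\<^sub>R \<phi>' \<theta>\<bar>)) = ?w"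
    by (auto simp: indicator_def)
  finally have w[measurable]: "?w \<in> borel_measurable borel" .
  have uI: "(\<integral>\<^sup>+\<theta>. ?u \<theta> * indicator {y..t} \<theta> \<partial>lborel) = ennreal \<bar>H t - H y\<bar>"
    if "y \<le> t" "{y..t} \<subseteq> \<Theta>" for y t
  proof -
    have "(\<integral>\<^sup>+\<theta>. ?u \<theta> * indicator {y..t} \<theta> \<partial>lborel)
        = (\<integral>\<^sup>+\<theta>. ennreal \<bar>deriv H \<theta>\<bar> * indicator {y..t} \<theta> \<partial>lborel)"
      using that by (intro nn_integral_cong) (auto simp: indicator_def)
    also have "\<dots> = ennreal \<bar>H t - H y\<bar>"
      by (rule nn_integral_abs_deriv_Icc[OF H' \<Theta> H diff mono that])
    finally show ?thesis .
  qed
  have wI: "(\<integral>\<^sup>+\<theta>. ?w \<theta> * indicator {y..t} \<theta> \<partial>lborel) = ennreal \<bar>H t - H y\<bar>"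
    if "y \<le> t" "{y..t} \<subseteq> \<Theta>" for y t
  proof -
    have "(\<integral>\<^sup>+\<theta>. ?w \<theta> * indicator {y..t} \<theta> \<partial>lborel)
        = (\<integral>\<^sup>+\<theta>. ennreal (g (\<phi> \<theta>) * \<bar>\<phi>' \<theta>\<bar>) * indicator {y..t} \<theta> \<partial>lborel)"
      using that by (intro nn_integral_cong) (auto simp: indicator_def)
    also have "\<dots> = ennreal \<bar>?H' t - ?H' y\<bar>"
      using that sign
      by (intro nn_integral_density_along_Icc[OF g prob] D continuous_on_subset[OF cont]) auto
    also have "\<dots> = ennreal \<bar>H t - H y\<bar>"
      using that by (subst (1 2) H) auto
    finally show ?thesis .
  qed
  have sub: "{l k..h k} \<subseteq> \<Theta>" for k using union by auto
  have "AE \<theta> in lborel. \<forall>k. \<theta> \<in> {l k..h k} \<longrightarrow> ?u \<theta> = ?w \<theta>"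
    unfolding AE_all_countable
  proof
    fix k
    show "AE \<theta> in lborel. \<theta> \<in> {l k..h k} \<longrightarrow> ?u \<theta> = ?w \<theta>"
    proof (rule AE_eq_if_nn_integral_Icc_eq[OF u w])
      show "(\<integral>\<^sup>+\<theta>. ?u \<theta> * indicator {l k..h k} \<theta> \<partial>lborel) < \<infinity>"
        using uI[OF le sub] by simp
      fix y assume "l k \<le> y" "y \<le> h k"
      then have "y \<le> h k" "{y..h k} \<subseteq> \<Theta>" using sub[of k] by auto
      from uI[OF this] wI[OF this]
      show "(\<integral>\<^sup>+\<theta>. ?u \<theta> * indicator {y..h k} \<theta> \<partial>lborel) = (\<integral>\<^sup>+\<theta>. ?w \<theta> * indicator {y..h k} \<theta> \<partial>lborel)"
        by simp
    qed
  qed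
  then have "AE \<theta> in lborel. ?u \<theta> = ?w \<theta>"
    by eventually_elim (use union[symmetric] in \<open>force simp: indicator_def\<close>)
  then show "density lborel ?u = density lborel ?w"
    using u w by (intro density_cong) auto
  have "(\<lambda>k. emeasure (density lborel ?u) {l k..h k}) \<longlonglongrightarrow> emeasure (density lborel ?u) (\<Union>k. {l k..h k})"
    using inc by (intro Lim_emeasure_incseq) auto
  also have "emeasure (density lborel ?u) (\<Union>k. {l k..h k}) = emeasure (density lborel ?u) UNIV"
    unfolding union using \<Theta> by (simp add: emeasure_density mult.assoc flip: indicator_inter_arith)
  also have "(\<lambda>k. emeasure (density lborel ?u) {l k..h k}) = (\<lambda>k. ennreal \<bar>H (h k) - H (l k)\<bar>)"
    using uI[OF le sub] by (simp add: emeasure_density)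
  finally have "(\<lambda>k. ennreal \<bar>H (h k) - H (l k)\<bar>) \<longlonglongrightarrow> emeasure (density lborel ?u) UNIV" .
  moreover have "(\<lambda>k. ennreal \<bar>H (h k) - H (l k)\<bar>) \<longlonglongrightarrow> ennreal 1"
    using lim by (intro tendsto_ennrealI)
  ultimately have "emeasure (density lborel ?u) UNIV = ennreal 1"
    by (rule LIMSEQ_unique)
  then show "prob_space (density lborel ?u)"
    by (intro prob_spaceI) simp
qed

section \<open>Families generated by affine maps\<close>

text \<open>Used twice: to pass from rational to real arguments of conditional distribution functions, and from
  rational to real parameters.\<close>

lemma eq_at_if_eq_on_rationals_right:
  fixes F G :: "real \<Rightarrow> real"
  assumes F: "(F \<longlongrightarrow> F x) (at_right x)" and G: "(G \<longlongrightarrow> G x) (at_right x)"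
    and eq: "\<forall>\<^sub>F y in at_right x. y \<in> \<rat> \<longrightarrow> F y = G y"
  shows "F x = G x"
proof (rule ccontr)
  assume "F x \<noteq> G x"
  then have "\<forall>\<^sub>F y in at_right x. F y - G y \<noteq> 0"
    by (intro tendsto_imp_eventually_ne[OF tendsto_diff[OF F G]]) simp
  with eq have "\<forall>\<^sub>F y in at_right x. y \<notin> \<rat>"
    by eventually_elim auto
  then obtain d where "x < d" and d: "\<And>y. x < y \<Longrightarrow> y < d \<Longrightarrow> y \<notin> \<rat>"
    by (auto simp: eventually_at_right_field)
  with Rats_dense_in_real[OF \<open>x < d\<close>] show False by blast
qed

text \<open>The common form of location and scale families. The group of maps \<open>v \<mapsto> m \<theta> + s \<theta> * v\<close>
  generates the family, and equivariance of \<open>a\<close> and \<open>b\<close> under it makes the residuals ancillary. The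
  function \<open>j\<close>, read off from the derivative of the pivot \<open>(x - m \<theta>) / s \<theta>\<close>, will be the
  prior. The intervals \<open>{l k..h k}\<close> exhaust the parameter space, so that
  the limits of the conditional distribution function at its boundary can be taken along
  sequences.\<close>

locale affine_fiducial_model = fiducial_model \<Theta> lo p n Z P X K
  for \<Theta> :: "real set" and lo :: "real filter" and p :: "real \<Rightarrow> real \<Rightarrow> real" and n :: nat
    and Z :: "(nat \<Rightarrow> real) \<Rightarrow> nat \<Rightarrow> real" and P :: "real \<Rightarrow> 'w measure"
    and X :: "nat \<Rightarrow> 'w \<Rightarrow> real" and K :: "real \<Rightarrow> (nat \<Rightarrow> real) \<Rightarrow> real measure" +
  fixes f a b m s j :: "real \<Rightarrow> real" and l h :: "nat \<Rightarrow> real"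
  assumes density_f: "probability_density f"
    and p_eq: "\<And>\<theta> x. p \<theta> x = f ((x - m \<theta>) / s \<theta>) / s \<theta>"
    and Z_eq: "\<And>x. Z x = (\<lambda>i\<in>{2..n}. (x i - a (x 1)) / b (x 1))"
    and a_measurable[measurable]: "a \<in> borel_measurable borel"
    and b_measurable[measurable]: "b \<in> borel_measurable borel"
    and b_nonzero: "AE u in lborel. b u \<noteq> 0"
    and s_pos: "\<And>\<theta>. \<theta> \<in> \<Theta> \<Longrightarrow> 0 < s \<theta>"
    and a_affine: "\<And>\<theta> v. \<theta> \<in> \<Theta> \<Longrightarrow> a (m \<theta> + s \<theta> * v) = m \<theta> + s \<theta> * a v"
    and b_affine: "\<And>\<theta> v. \<theta> \<in> \<Theta> \<Longrightarrow> b (m \<theta> + s \<theta> * v) = s \<theta> * b v"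
    and open_\<Theta>: "open \<Theta>" and exhaustion_le: "\<And>k. l k \<le> h k"
    and exhaustion_inc: "incseq (\<lambda>k. {l k..h k})" and exhaustion: "(\<Union>k. {l k..h k}) = \<Theta>"
    and l_lim: "filterlim l lo sequentially" and h_lim: "filterlim h at_top sequentially"
    and m_measurable[measurable]: "m \<in> borel_measurable borel"
    and s_measurable[measurable]: "s \<in> borel_measurable borel"
    and pivot_deriv: "\<And>\<theta> x. \<theta> \<in> \<Theta> \<Longrightarrow>
      ((\<lambda>\<theta>. (x - m \<theta>) / s \<theta>) has_real_derivative - b x * j \<theta> / s \<theta>) (at \<theta>)"
    and s_cont: "continuous_on \<Theta> s" and j_cont: "continuous_on \<Theta> j"
    and j_pos: "\<And>\<theta>. \<theta> \<in> \<Theta> \<Longrightarrow> 0 < j \<theta>"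
begin

abbreviation residual_space :: "(nat \<Rightarrow> real) measure" where
  "residual_space \<equiv> PiM {2..n} (\<lambda>_. borel)"

abbreviation residual_lborel :: "(nat \<Rightarrow> real) measure" where
  "residual_lborel \<equiv> PiM {2..n} (\<lambda>_. lborel)"

text \<open>The joint density of the first observation \<open>v\<close> and the residuals \<open>z\<close> for a sample
  from \<open>f\<close> itself.\<close>

definition standard_density :: "(nat \<Rightarrow> real) \<Rightarrow> real \<Rightarrow> real" where
  "standard_density z v = f v * (\<Prod>i\<in>{2..n}. \<bar>b v\<bar> * f (a v + b v * z i))"

text \<open>The density of the residuals under every parameter, see \<open>distr_Z\<close> below.\<close>

definition ancillary_density :: "(nat \<Rightarrow> real) \<Rightarrow> ennreal" where
  "ancillary_density z = (\<integral>\<^sup>+v. ennreal (standard_density z v) \<partial>lborel)"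

definition conditional_density :: "(nat \<Rightarrow> real) \<Rightarrow> real \<Rightarrow> real" where
  "conditional_density z v = standard_density z v / enn2real (ancillary_density z)"

lemma f_measurable[measurable]: "f \<in> borel_measurable borel"
  and f_nonneg: "0 \<le> f x"
  using density_f by (auto simp: probability_density_def)

lemma p_nonneg: "\<theta> \<in> \<Theta> \<Longrightarrow> 0 \<le> p \<theta> x"
  using s_pos[of \<theta>] f_nonneg by (simp add: p_eq)

lemma standard_density_nonneg: "0 \<le> standard_density z v"
  unfolding standard_density_def by (intro mult_nonneg_nonneg prod_nonneg) (auto simp: f_nonneg)

lemma standard_density_measurable[measurable]: "standard_density z \<in> borel_measurable borel"
  unfolding standard_density_def[abs_def] by measurable

lemma conditional_density_measurable[measurable]: "conditional_density z \<in> borel_measurable borel"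
  unfolding conditional_density_def[abs_def] by measurable

lemma sets_residual_lborel: "sets residual_lborel = sets residual_space"
  by (intro sets_PiM_cong) auto

lemma standard_density_pair_measurable:
  "(\<lambda>(z, v). standard_density z v) \<in> borel_measurable (residual_lborel \<Otimes>\<^sub>M lborel)"
  unfolding standard_density_def by measurable

lemma nn_integral_standard_density_measurable:
  assumes [measurable]: "A \<in> sets borel"
  shows "(\<lambda>z. \<integral>\<^sup>+v. ennreal (standard_density z v) * indicator A v \<partial>lborel)
    \<in> borel_measurable residual_lborel"
proof (rule lborel.borel_measurable_nn_integral)
  show "(\<lambda>(z, v). ennreal (standard_density z v) * indicator A v)
      \<in> borel_measurable (residual_lborel \<Otimes>\<^sub>M lborel)"
    using standard_density_pair_measurable by (simp add: case_prod_unfold)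
qed

lemma ancillary_density_measurable: "ancillary_density \<in> borel_measurable residual_lborel"
  using nn_integral_standard_density_measurable[of UNIV]
  by (simp add: ancillary_density_def[abs_def])

text \<open>By equivariance each factor \<open>|b u| * p \<theta> (a u + b u * z i)\<close> is unchanged when
  \<open>u\<close> is replaced by \<open>v = (u - m \<theta>) / s \<theta>\<close> and \<open>p \<theta>\<close> by \<open>f\<close>: the factor
  \<open>s \<theta>\<close> gained by \<open>b\<close> cancels the one in the denominator of \<open>p\<close>. Only the first
  observation contributes a factor \<open>1 / s \<theta>\<close>.\<close>

lemma joint_density_eq_standard_density:
  assumes "\<theta> \<in> \<Theta>"
  shows "p \<theta> u * (\<Prod>i\<in>{2..n}. \<bar>b u\<bar> * p \<theta> (a u + b u * z i))
    = standard_density z ((u - m \<theta>) / s \<theta>) / s \<theta>"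
proof -
  define v where "v = (u - m \<theta>) / s \<theta>"
  have s0: "0 < s \<theta>" using assms by (rule s_pos)
  have u: "u = m \<theta> + s \<theta> * v" using s0 by (simp add: v_def)
  have "\<bar>b u\<bar> * p \<theta> (a u + b u * z i) = \<bar>b v\<bar> * f (a v + b v * z i)" for i
  proof -
    have "(a u + b u * z i - m \<theta>) / s \<theta> = a v + b v * z i"
      using s0 unfolding u a_affine[OF assms] b_affine[OF assms] by (simp add: field_simps)
    then show ?thesis
      using s0 by (simp add: p_eq) (simp add: u b_affine[OF assms] abs_mult)
  qed
  then show ?thesis
    unfolding v_def[symmetric] standard_density_def by (simp add: p_eq v_def)
qed

lemma nn_integral_joint_density:
  assumes \<theta>: "\<theta> \<in> \<Theta>" and [measurable]: "A \<in> sets borel"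
  shows "(\<integral>\<^sup>+u. ennreal (p \<theta> u) * (\<Prod>i\<in>{2..n}. ennreal \<bar>b u\<bar> * ennreal (p \<theta> (a u + b u * z i)))
      * indicator A u \<partial>lborel)
    = (\<integral>\<^sup>+v. ennreal (standard_density z v) * indicator A (m \<theta> + s \<theta> * v) \<partial>lborel)"
proof -
  have s0: "0 < s \<theta>" using \<theta> by (rule s_pos)
  have "(\<integral>\<^sup>+u. ennreal (p \<theta> u) * (\<Prod>i\<in>{2..n}. ennreal \<bar>b u\<bar> * ennreal (p \<theta> (a u + b u * z i)))
      * indicator A u \<partial>lborel)
    = (\<integral>\<^sup>+u. ennreal (standard_density z ((u - m \<theta>) / s \<theta>) / s \<theta>) * indicator A u \<partial>lborel)"
    unfolding joint_density_eq_standard_density[OF \<theta>, symmetric]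
    by (simp add: ennreal_mult p_nonneg[OF \<theta>] prod_nonneg flip: prod_ennreal)
  also have "\<dots> = ennreal \<bar>s \<theta>\<bar> * (\<integral>\<^sup>+v. ennreal (standard_density z ((m \<theta> + s \<theta> * v - m \<theta>) / s \<theta>) / s \<theta>)
      * indicator A (m \<theta> + s \<theta> * v) \<partial>lborel)"
    using s0 by (intro nn_integral_real_affine) auto
  also have "\<dots> = (\<integral>\<^sup>+v. ennreal \<bar>s \<theta>\<bar> * (ennreal (standard_density z v / s \<theta>)
      * indicator A (m \<theta> + s \<theta> * v)) \<partial>lborel)"
    using s0 by (subst nn_integral_cmult[symmetric]) auto
  also have "\<dots> = (\<integral>\<^sup>+v. ennreal (standard_density z v) * indicator A (m \<theta> + s \<theta> * v) \<partial>lborel)"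
    using s0 standard_density_nonneg
    by (intro nn_integral_cong) (simp flip: mult.assoc ennreal_mult)
  finally show ?thesis .
qed

lemma joint_law:
  assumes \<theta>: "\<theta> \<in> \<Theta>" and A[measurable]: "A \<in> sets borel" and B: "B \<in> sets residual_space"
  shows "emeasure (P \<theta>) {w\<in>space (P \<theta>). X 1 w \<in> A \<and> Z (\<lambda>i. X i w) \<in> B}
    = (\<integral>\<^sup>+z. (\<integral>\<^sup>+v. ennreal (standard_density z v) * indicator A (m \<theta> + s \<theta> * v) \<partial>lborel)
        * indicator B z \<partial>residual_lborel)"
  unfolding Z_eq
  by (subst joint_law_first_and_residuals[OF prob_space_P[OF \<theta>] sample_size independent[OF \<theta>]
        identically_distributed[OF \<theta>] a_measurable b_measurable b_nonzero A B])
    (simp_all add: nn_integral_joint_density[OF \<theta> A])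

lemma Z_measurable: "\<theta> \<in> \<Theta> \<Longrightarrow> (\<lambda>w. Z (\<lambda>i. X i w)) \<in> measurable (P \<theta>) residual_space"
  and K_measurable: "\<theta> \<in> \<Theta> \<Longrightarrow> K \<theta> \<in> measurable residual_space (prob_algebra borel)"
  and K_conditional: "\<theta> \<in> \<Theta> \<Longrightarrow> A \<in> sets borel \<Longrightarrow> B \<in> sets residual_space \<Longrightarrow>
    emeasure (P \<theta>) {w \<in> space (P \<theta>). X 1 w \<in> A \<and> Z (\<lambda>i. X i w) \<in> B} =
        (\<integral>\<^sup>+z. emeasure (K \<theta> z) A * indicator B z
          \<partial>distr (P \<theta>) residual_space (\<lambda>w. Z (\<lambda>i. X i w)))"
  using conditional[of \<theta>] by (auto simp: regular_conditional_distribution_def)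

lemma distr_Z:
  assumes \<theta>: "\<theta> \<in> \<Theta>"
  shows "distr (P \<theta>) residual_space (\<lambda>w. Z (\<lambda>i. X i w)) = density residual_lborel ancillary_density"
proof (rule measure_eqI)
  show "sets (distr (P \<theta>) residual_space (\<lambda>w. Z (\<lambda>i. X i w)))
      = sets (density residual_lborel ancillary_density)"
    by (simp add: sets_residual_lborel)
  fix B assume "B \<in> sets (distr (P \<theta>) residual_space (\<lambda>w. Z (\<lambda>i. X i w)))"
  then have B: "B \<in> sets residual_space" by simp
  have "emeasure (distr (P \<theta>) residual_space (\<lambda>w. Z (\<lambda>i. X i w))) B
      = emeasure (P \<theta>) {w\<in>space (P \<theta>). X 1 w \<in> UNIV \<and> Z (\<lambda>i. X i w) \<in> B}"
    by (subst emeasure_distr[OF Z_measurable[OF \<theta>] B])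
      (auto intro!: arg_cong[where f="emeasure (P \<theta>)"])
  also have "\<dots> = (\<integral>\<^sup>+z. ancillary_density z * indicator B z \<partial>residual_lborel)"
    by (subst joint_law[OF \<theta> _ B]) (simp_all add: ancillary_density_def)
  also have "\<dots> = emeasure (density residual_lborel ancillary_density) B"
    using B by (intro emeasure_density[symmetric] ancillary_density_measurable)
      (simp add: sets_residual_lborel)
  finally show "emeasure (distr (P \<theta>) residual_space (\<lambda>w. Z (\<lambda>i. X i w))) B
    = emeasure (density residual_lborel ancillary_density) B" .
qed

text \<open>Bayes' rule in product form: multiplied by the density of the residuals, the conditional
  distribution function and the integral of the joint density have the same integrals over all sets of
  residuals, hence agree almost everywhere.\<close>

lemma conditional_cdf_AE:
  assumes \<theta>: "\<theta> \<in> \<Theta>"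
  shows "AE z in residual_lborel. emeasure (K \<theta> z) {..x} * ancillary_density z
    = (\<integral>\<^sup>+v. ennreal (standard_density z v) * indicator {..(x - m \<theta>) / s \<theta>} v \<partial>lborel)"
    (is "AE z in _. ?L z = ?R z")
proof -
  interpret L: finite_product_sigma_finite "\<lambda>_::nat. lborel :: real measure" "{2..n}"
    by standard simp
  have s0: "0 < s \<theta>" using \<theta> by (rule s_pos)
  have K: "(\<lambda>z. emeasure (K \<theta> z) {..x}) \<in> borel_measurable residual_space"
    by (rule measurable_compose[OF measurable_prob_algebraD[OF K_measurable[OF \<theta>]]
          measurable_emeasure_subprob_algebra]) simp
  then have K': "(\<lambda>z. emeasure (K \<theta> z) {..x}) \<in> borel_measurable residual_lborel"
    by (simp cong: measurable_cong_sets add: measurable_cong_sets[OF sets_residual_lborel refl])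
  have Lm: "?L \<in> borel_measurable residual_lborel"
    using K' ancillary_density_measurable by measurable
  have Rm: "?R \<in> borel_measurable residual_lborel"
    by (rule nn_integral_standard_density_measurable) simp
  have "density residual_lborel ?L = density residual_lborel ?R"
  proof (rule measure_eqI)
    fix B assume "B \<in> sets (density residual_lborel ?L)"
    then have B: "B \<in> sets residual_lborel" by simp
    then have B': "B \<in> sets residual_space" by (simp add: sets_residual_lborel)
    have "emeasure (density residual_lborel ?L) B = (\<integral>\<^sup>+z. ?L z * indicator B z \<partial>residual_lborel)"
      by (rule emeasure_density[OF Lm B])
    also have "\<dots> = (\<integral>\<^sup>+z. ancillary_density z * (emeasure (K \<theta> z) {..x} * indicator B z) \<partial>residual_lborel)"
      by (simp add: ac_simps)
    also have "\<dots> = (\<integral>\<^sup>+z. emeasure (K \<theta> z) {..x} * indicator B z \<partial>density residual_lborel ancillary_density)"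
      using K' B by (intro nn_integral_density[symmetric] ancillary_density_measurable) auto
    also have "\<dots> = emeasure (P \<theta>) {w \<in> space (P \<theta>). X 1 w \<in> {..x} \<and> Z (\<lambda>i. X i w) \<in> B}"
      unfolding distr_Z[OF \<theta>, symmetric] by (rule K_conditional[OF \<theta> _ B', symmetric]) simp
    also have "\<dots> = (\<integral>\<^sup>+z. (\<integral>\<^sup>+v. ennreal (standard_density z v) * indicator {..x} (m \<theta> + s \<theta> * v) \<partial>lborel)
        * indicator B z \<partial>residual_lborel)"
      by (rule joint_law[OF \<theta> _ B']) simp
    also have "\<dots> = (\<integral>\<^sup>+z. ?R z * indicator B z \<partial>residual_lborel)"
    proof -
      have "indicator {..x} (m \<theta> + s \<theta> * v) = (indicator {..(x - m \<theta>) / s \<theta>} v :: ennreal)" for v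
        using s0 by (auto simp: indicator_def field_simps)
      then show ?thesis by simp
    qed
    also have "\<dots> = emeasure (density residual_lborel ?R) B"
      by (rule emeasure_density[OF Rm B, symmetric])
    finally show "emeasure (density residual_lborel ?L) B = emeasure (density residual_lborel ?R) B" .
  qed simp
  then show ?thesis
    by (rule sigma_finite_measure.density_unique[OF L.sigma_finite_measure_axioms Lm Rm])
qed

lemma prob_space_conditional_density:
  assumes "ancillary_density z \<noteq> 0" "ancillary_density z \<noteq> \<infinity>"
  shows "prob_space (density lborel (conditional_density z))"
proof (rule prob_spaceI)
  define c where "c = enn2real (ancillary_density z)"
  have c: "ancillary_density z = ennreal c" "0 < c"
    using assms by (auto simp: c_def enn2real_positive_iff less_top[symmetric] zero_less_iff_neq_zero)
  have "conditional_density z = (\<lambda>v. standard_density z v / c)"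
    by (simp add: conditional_density_def[abs_def] c_def)
  then have "emeasure (density lborel (conditional_density z)) UNIV
      = (\<integral>\<^sup>+v. ennreal (standard_density z v) / ennreal c \<partial>lborel)"
    using c by (simp add: emeasure_density divide_ennreal standard_density_nonneg)
  also have "\<dots> = ancillary_density z / ennreal c"
    by (simp add: nn_integral_divide ancillary_density_def)
  also have "\<dots> = 1" using c by (simp add: divide_ennreal)
  finally show "emeasure (density lborel (conditional_density z))
      (space (density lborel (conditional_density z))) = 1" by simp
qed

text \<open>Conditional laws are determined only up to null sets of residuals, and these null sets may depend
  on \<open>\<theta>\<close> and \<open>x\<close>. Countably many of them can be discarded at once, hence the rational
  parameters; the points \<open>x\<close> are then recovered by right continuity.\<close>

lemma conditional_cdf_eq_AE:
  "AE z in residual_lborel.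
    ancillary_density z \<noteq> 0 \<longrightarrow> ancillary_density z \<noteq> \<infinity> \<and>
      (\<forall>\<theta>\<in>\<Theta> \<inter> \<rat>. \<forall>x. cdf (K \<theta> z) x
        = cdf (density lborel (conditional_density z)) ((x - m \<theta>) / s \<theta>))"
proof -
  obtain \<theta>\<^sub>0 where \<theta>\<^sub>0: "\<theta>\<^sub>0 \<in> \<Theta>"
    using exhaustion exhaustion_le[of 0] by force
  have "(\<integral>\<^sup>+z. ancillary_density z \<partial>residual_lborel)
      = emeasure (distr (P \<theta>\<^sub>0) residual_space (\<lambda>w. Z (\<lambda>i. X i w))) (space residual_lborel)"
    unfolding distr_Z[OF \<theta>\<^sub>0] by (subst emeasure_density)
      (auto intro!: ancillary_density_measurable nn_integral_cong)
  also have "\<dots> = 1"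
    using prob_space.emeasure_space_1[OF prob_space.prob_space_distr[OF prob_space_P[OF \<theta>\<^sub>0]
        Z_measurable[OF \<theta>\<^sub>0]]]
    by (simp add: space_PiM)
  finally have "(\<integral>\<^sup>+z. ancillary_density z \<partial>residual_lborel) \<noteq> \<infinity>" by simp
  then have fin: "AE z in residual_lborel. ancillary_density z \<noteq> \<infinity>"
    by (rule nn_integral_PInf_AE[OF ancillary_density_measurable])
  have cdfs: "AE z in residual_lborel. \<forall>\<theta>\<in>\<Theta> \<inter> \<rat>. \<forall>x\<in>\<rat>.
      emeasure (K \<theta> z) {..x} * ancillary_density z
      = (\<integral>\<^sup>+v. ennreal (standard_density z v) * indicator {..(x - m \<theta>) / s \<theta>} v \<partial>lborel)"
    using countable_rat by (intro AE_ball_countable[THEN iffD2] ballI countable_Int2 conditional_cdf_AE) auto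
  have "AE z in residual_lborel. z \<in> space residual_lborel" by (rule AE_space)
  with fin cdfs show ?thesis
  proof eventually_elim
    fix z
    assume fin: "ancillary_density z \<noteq> \<infinity>" and "z \<in> space residual_lborel"
      and eq: "\<forall>\<theta>\<in>\<Theta> \<inter> \<rat>. \<forall>x\<in>\<rat>. emeasure (K \<theta> z) {..x} * ancillary_density z
      = (\<integral>\<^sup>+v. ennreal (standard_density z v) * indicator {..(x - m \<theta>) / s \<theta>} v \<partial>lborel)"
    then have z: "z \<in> space residual_space" by (simp add: space_PiM)
    have "cdf (K \<theta> z) x = cdf (density lborel (conditional_density z)) ((x - m \<theta>) / s \<theta>)"
      if pos: "ancillary_density z \<noteq> 0" and \<theta>: "\<theta> \<in> \<Theta>" "\<theta> \<in> \<rat>" for \<theta> x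
    proof -
      let ?D = "density lborel (conditional_density z)"
      have s0: "0 < s \<theta>" using \<theta> by (intro s_pos)
      define c where "c = enn2real (ancillary_density z)"
      have c: "ancillary_density z = ennreal c" "0 < c"
        using fin pos by (auto simp: c_def enn2real_positive_iff less_top[symmetric] zero_less_iff_neq_zero)
      interpret D: prob_space ?D
        by (rule prob_space_conditional_density[OF pos fin])
      interpret D: finite_borel_measure ?D by standard auto
      have "K \<theta> z \<in> space (prob_algebra borel)"
        by (rule measurable_space[OF K_measurable[OF \<theta>(1)] z])
      then have K: "prob_space (K \<theta> z)" "sets (K \<theta> z) = sets borel"
        by (auto simp: space_prob_algebra)
      interpret K: prob_space "K \<theta> z" by (rule K(1))
      interpret K: finite_borel_measure "K \<theta> z" by standard (rule K(2))
      have rat: "cdf (K \<theta> z) y = cdf ?D ((y - m \<theta>) / s \<theta>)" if "y \<in> \<rat>" for y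
      proof -
        let ?A = "{..(y - m \<theta>) / s \<theta>}"
        have "ennreal (cdf (K \<theta> z) y * c) = emeasure (K \<theta> z) {..y} * ancillary_density z"
          using c by (simp add: cdf_def K.emeasure_eq_measure ennreal_mult)
        also have "\<dots> = (\<integral>\<^sup>+v. ennreal (standard_density z v) * indicator ?A v \<partial>lborel)"
          using eq \<theta> that by blast
        also have "\<dots> = (\<integral>\<^sup>+v. ennreal c * (ennreal (conditional_density z v) * indicator ?A v) \<partial>lborel)"
          using c(2) standard_density_nonneg
          by (intro nn_integral_cong)
            (simp add: conditional_density_def c_def[symmetric] flip: mult.assoc ennreal_mult)
        also have "\<dots> = ennreal c * emeasure ?D ?A"
          by (subst nn_integral_cmult) (auto simp: emeasure_density)
        also have "\<dots> = ennreal (cdf ?D ((y - m \<theta>) / s \<theta>) * c)"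
          using c(2) by (simp add: cdf_def D.emeasure_eq_measure ennreal_mult mult.commute)
        finally show ?thesis
          using c(2) by (simp add: cdf_def)
      qed
      have "((\<lambda>y. cdf ?D ((y - m \<theta>) / s \<theta>)) \<longlongrightarrow> cdf ?D ((x - m \<theta>) / s \<theta>)) (at_right x)"
      proof (rule filterlim_compose[OF D.cdf_is_right_cont[unfolded continuous_within]])
        show "filterlim (\<lambda>y. (y - m \<theta>) / s \<theta>) (at_right ((x - m \<theta>) / s \<theta>)) (at_right x)"
          unfolding filterlim_at
        proof
          show "\<forall>\<^sub>F y in at_right x. (y - m \<theta>) / s \<theta> \<in> {(x - m \<theta>) / s \<theta><..} \<and> (y - m \<theta>) / s \<theta> \<noteq> (x - m \<theta>) / s \<theta>"
            using eventually_at_right_less[of x]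
            by eventually_elim (use s0 in \<open>auto simp: divide_strict_right_mono\<close>)
          show "((\<lambda>y. (y - m \<theta>) / s \<theta>) \<longlongrightarrow> (x - m \<theta>) / s \<theta>) (at_right x)"
            using s0 by (intro tendsto_intros) auto
        qed
      qed
      then show ?thesis
        using rat K.cdf_is_right_cont[of x]
        by (intro eq_at_if_eq_on_rationals_right[of "cdf (K \<theta> z)"]) (auto simp: continuous_within)
    qed
    with fin show "ancillary_density z \<noteq> 0 \<longrightarrow> ancillary_density z \<noteq> \<infinity> \<and>
      (\<forall>\<theta>\<in>\<Theta> \<inter> \<rat>. \<forall>x. cdf (K \<theta> z) x
        = cdf (density lborel (conditional_density z)) ((x - m \<theta>) / s \<theta>))"
      by blast
  qed
qed

lemma pivot_sign:
  "(\<forall>\<theta>\<in>\<Theta>. 0 \<le> - b x * j \<theta> / s \<theta>) \<or> (\<forall>\<theta>\<in>\<Theta>. - b x * j \<theta> / s \<theta> \<le> 0)"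
proof (cases "b x \<le> 0")
  case True
  then have "0 \<le> - b x * j \<theta> / s \<theta>" if "\<theta> \<in> \<Theta>" for \<theta>
    using j_pos[OF that] s_pos[OF that] by (intro divide_nonneg_pos mult_nonneg_nonneg) auto
  then show ?thesis by blast
next
  case False
  then have "- b x * j \<theta> / s \<theta> \<le> 0" if "\<theta> \<in> \<Theta>" for \<theta>
    using j_pos[OF that] s_pos[OF that] by (auto intro!: divide_nonpos_pos mult_nonneg_nonneg)
  then show ?thesis by blast
qed

text \<open>For a fixed sample outside the exceptional null sets, continuity in the parameter extends the
  formula for the conditional distribution function to all of \<open>\<Theta>\<close>, and the differentiated formula is
  likelihood times prior by \<open>joint_density_eq_standard_density\<close>.\<close>

lemma fiducial_is_posterior_if_regular:
  fixes x :: "nat \<Rightarrow> real"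
  assumes adm: "admissible_in_parameter \<Theta> lo (\<lambda>\<theta>. cdf (K \<theta> (Z x)) (x 1))"
    and b0: "b (x 1) \<noteq> 0"
    and pos: "ancillary_density (Z x) \<noteq> 0" and fin: "ancillary_density (Z x) \<noteq> \<infinity>"
    and cdf: "\<And>\<theta> y. \<theta> \<in> \<Theta> \<Longrightarrow> \<theta> \<in> \<rat> \<Longrightarrow> cdf (K \<theta> (Z x)) y
        = cdf (density lborel (conditional_density (Z x))) ((y - m \<theta>) / s \<theta>)"
    and prior: "proportional_on \<Theta> \<pi> j"
  shows "is_posterior \<Theta> \<pi> p n x (fiducial_distribution \<Theta> Z K x)"
proof -
  define H where "H = (\<lambda>\<theta>. cdf (K \<theta> (Z x)) (x 1))"
  define \<phi> where "\<phi> = (\<lambda>\<theta>. (x 1 - m \<theta>) / s \<theta>)"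
  let ?g = "conditional_density (Z x)"
  let ?D = "density lborel ?g"
  have prob: "prob_space ?D" by (rule prob_space_conditional_density[OF pos fin])
  interpret D: prob_space ?D by (rule prob)
  interpret D: finite_borel_measure ?D by standard auto
  have mono: "mono_on \<Theta> H \<or> antimono_on \<Theta> H"
    and diff: "\<And>\<theta>. \<theta> \<in> \<Theta> \<Longrightarrow> H differentiable (at \<theta>)"
    and lims: "(H \<longlongrightarrow> 0) lo \<and> (H \<longlongrightarrow> 1) at_top \<or> (H \<longlongrightarrow> 1) lo \<and> (H \<longlongrightarrow> 0) at_top"
    using adm by (auto simp: admissible_in_parameter_def H_def)
  have D\<phi>: "(\<phi> has_real_derivative - b (x 1) * j \<theta> / s \<theta>) (at \<theta>)" if "\<theta> \<in> \<Theta>" for \<theta>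
    unfolding \<phi>_def by (rule pivot_deriv[OF that])
  have H: "H \<theta> = cdf ?D (\<phi> \<theta>)" if \<theta>: "\<theta> \<in> \<Theta>" for \<theta>
  proof (rule eq_at_if_eq_on_rationals_right[where F=H and G="\<lambda>\<theta>. cdf ?D (\<phi> \<theta>)"])
    show "(H \<longlongrightarrow> H \<theta>) (at_right \<theta>)"
      using differentiable_imp_continuous_within[OF diff[OF \<theta>]]
      by (auto simp: continuous_within intro: tendsto_within_subset)
    have "emeasure ?D {\<phi> \<theta>} = (\<integral>\<^sup>+v. ennreal (?g v) * indicator {\<phi> \<theta>} v \<partial>lborel)"
      by (subst emeasure_density) auto
    also have "\<dots> = (\<integral>\<^sup>+v. 0 \<partial>(lborel :: real measure))"
      using AE_lborel_singleton[of "\<phi> \<theta>"]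
      by (intro nn_integral_cong_AE, eventually_elim) auto
    finally have "measure ?D {\<phi> \<theta>} = 0" by (simp add: measure_def)
    then have "isCont (cdf ?D) (\<phi> \<theta>)" by (simp add: D.isCont_cdf)
    then have "isCont (\<lambda>\<theta>. cdf ?D (\<phi> \<theta>)) \<theta>"
      by (rule isCont_o2[OF DERIV_isCont[OF D\<phi>[OF \<theta>]]])
    then show "((\<lambda>\<theta>. cdf ?D (\<phi> \<theta>)) \<longlongrightarrow> cdf ?D (\<phi> \<theta>)) (at_right \<theta>)"
      by (auto simp: isCont_def intro: tendsto_within_subset)
    have "\<forall>\<^sub>F y in at_right \<theta>. y \<in> \<Theta>"
      using eventually_nhds_in_open[OF open_\<Theta> \<theta>] by (auto simp: eventually_at_filter elim: eventually_mono)
    then show "\<forall>\<^sub>F y in at_right \<theta>. y \<in> \<rat> \<longrightarrow> H y = cdf ?D (\<phi> y)"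
      by eventually_elim (simp add: H_def \<phi>_def cdf)
  qed
  have lim: "(\<lambda>k. \<bar>H (h k) - H (l k)\<bar>) \<longlonglongrightarrow> 1"
    using lims
  proof
    assume "(H \<longlongrightarrow> 0) lo \<and> (H \<longlongrightarrow> 1) at_top"
    then have "(\<lambda>k. \<bar>H (h k) - H (l k)\<bar>) \<longlonglongrightarrow> \<bar>1 - 0\<bar>"
      using l_lim h_lim by (intro tendsto_rabs tendsto_diff) (auto intro: filterlim_compose)
    then show ?thesis by simp
  next
    assume "(H \<longlongrightarrow> 1) lo \<and> (H \<longlongrightarrow> 0) at_top"
    then have "(\<lambda>k. \<bar>H (h k) - H (l k)\<bar>) \<longlonglongrightarrow> \<bar>0 - 1\<bar>"
      using l_lim h_lim by (intro tendsto_rabs tendsto_diff) (auto intro: filterlim_compose)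
    then show ?thesis by simp
  qed
  have \<phi>m: "\<phi> \<in> borel_measurable borel" unfolding \<phi>_def by measurable
  have cont: "continuous_on \<Theta> (\<lambda>\<theta>. - b (x 1) * j \<theta> / s \<theta>)"
    using s_pos by (intro continuous_intros j_cont s_cont) force
  note main = density_abs_deriv_eq[OF conditional_density_measurable prob
      open_\<Theta> exhaustion_le exhaustion_inc exhaustion \<phi>m D\<phi> cont pivot_sign H diff mono lim]
  define c where "c = enn2real (ancillary_density (Z x))"
  have c: "0 < c"
    using fin pos by (auto simp: c_def enn2real_positive_iff less_top[symmetric] zero_less_iff_neq_zero)
  obtain d where d: "0 < d" "\<And>\<theta>. \<theta> \<in> \<Theta> \<Longrightarrow> \<pi> \<theta> = d * j \<theta>"
    using prior by (auto simp: proportional_on_def)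
  \<comment> \<open>One factor \<open>|b (x 1)|\<close> comes from each residual and one from the derivative of the
    pivot; \<open>c\<close> normalises the conditional density and \<open>d\<close> the prior.\<close>
  define C where "C = \<bar>b (x 1)\<bar> ^ card {2..n} * \<bar>b (x 1)\<bar> / (c * d)"
  have C: "0 < C" using b0 c d by (simp add: C_def)
  have key: "?g (\<phi> \<theta>) * \<bar>- b (x 1) * j \<theta> / s \<theta>\<bar> = C * (\<pi> \<theta> * (\<Prod>i=1..n. p \<theta> (x i)))"
    if \<theta>: "\<theta> \<in> \<Theta>" for \<theta>
  proof -
    have s0: "0 < s \<theta>" and j0: "0 < j \<theta>" using \<theta> by (auto intro: s_pos j_pos)
    have "standard_density (Z x) (\<phi> \<theta>) / s \<theta>
        = p \<theta> (x 1) * (\<Prod>i\<in>{2..n}. \<bar>b (x 1)\<bar> * p \<theta> (a (x 1) + b (x 1) * Z x i))"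
      unfolding \<phi>_def by (rule joint_density_eq_standard_density[OF \<theta>, symmetric])
    also have "(\<Prod>i\<in>{2..n}. \<bar>b (x 1)\<bar> * p \<theta> (a (x 1) + b (x 1) * Z x i))
        = (\<Prod>i\<in>{2..n}. \<bar>b (x 1)\<bar> * p \<theta> (x i))"
      using b0 by (intro prod.cong refl) (simp add: Z_eq)
    also have "\<dots> = \<bar>b (x 1)\<bar> ^ card {2..n} * (\<Prod>i\<in>{2..n}. p \<theta> (x i))"
      by (simp add: prod.distrib)
    also have "p \<theta> (x 1) * (\<bar>b (x 1)\<bar> ^ card {2..n} * (\<Prod>i\<in>{2..n}. p \<theta> (x i)))
        = \<bar>b (x 1)\<bar> ^ card {2..n} * (\<Prod>i=1..n. p \<theta> (x i))"
      using sample_size by (subst (2) prod.atLeast_Suc_atMost) (auto simp: numeral_2_eq_2)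
    finally have "standard_density (Z x) (\<phi> \<theta>)
        = s \<theta> * (\<bar>b (x 1)\<bar> ^ card {2..n} * (\<Prod>i=1..n. p \<theta> (x i)))"
      using s0 by (simp add: field_simps)
    then show ?thesis
      using s0 j0 c d \<theta> by (simp add: conditional_density_def c_def[symmetric] C_def abs_mult)
  qed
  have "fiducial_distribution \<Theta> Z K x
      = density lborel (\<lambda>\<theta>. ennreal (?g (\<phi> \<theta>) * \<bar>- b (x 1) * j \<theta> / s \<theta>\<bar>) * indicator \<Theta> \<theta>)"
    unfolding fiducial_distribution_def using main(1) by (simp only: H_def)
  also have "\<dots> = density lborel (\<lambda>\<theta>. ennreal (C * (\<pi> \<theta> * (\<Prod>i=1..n. p \<theta> (x i)))) * indicator \<Theta> \<theta>)"
  proof -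
    have "ennreal (?g (\<phi> \<theta>) * \<bar>- b (x 1) * j \<theta> / s \<theta>\<bar>) * indicator \<Theta> \<theta>
      = ennreal (C * (\<pi> \<theta> * (\<Prod>i=1..n. p \<theta> (x i)))) * indicator \<Theta> \<theta>" for \<theta>
      using key[of \<theta>] by (cases "\<theta> \<in> \<Theta>") simp_all
    then show ?thesis by presburger
  qed
  finally have eq: "fiducial_distribution \<Theta> Z K x
      = density lborel (\<lambda>\<theta>. ennreal (C * (\<pi> \<theta> * (\<Prod>i=1..n. p \<theta> (x i)))) * indicator \<Theta> \<theta>)" .
  have "prob_space (fiducial_distribution \<Theta> Z K x)"
    using main(2) by (simp add: fiducial_distribution_def H_def)
  with eq C show ?thesis unfolding is_posterior_def by blast
qed

lemma fiducial_is_posterior_AE: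
  assumes \<theta>\<^sub>0: "\<theta>\<^sub>0 \<in> \<Theta>" and prior: "proportional_on \<Theta> \<pi> j"
  shows "AE w in P \<theta>\<^sub>0. is_posterior \<Theta> \<pi> p n (\<lambda>i. X i w) (fiducial_distribution \<Theta> Z K (\<lambda>i. X i w))"
proof -
  have "AE z in density residual_lborel ancillary_density. ancillary_density z \<noteq> 0 \<and>
     ancillary_density z \<noteq> \<infinity> \<and> (\<forall>\<theta>\<in>\<Theta> \<inter> \<rat>. \<forall>x. cdf (K \<theta> z) x
        = cdf (density lborel (conditional_density z)) ((x - m \<theta>) / s \<theta>))"
    unfolding AE_density[OF ancillary_density_measurable]
    using conditional_cdf_eq_AE by eventually_elim auto
  \<comment> \<open>The residuals have the same law under \<open>\<theta>\<^sub>0\<close> as under the rational parameters, so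
    the exceptional sets of all of them are null for \<open>P \<theta>\<^sub>0\<close>.\<close>
  then have 1: "AE w in P \<theta>\<^sub>0. ancillary_density (Z (\<lambda>i. X i w)) \<noteq> 0 \<and>
     ancillary_density (Z (\<lambda>i. X i w)) \<noteq> \<infinity> \<and> (\<forall>\<theta>\<in>\<Theta> \<inter> \<rat>. \<forall>x. cdf (K \<theta> (Z (\<lambda>i. X i w))) x
        = cdf (density lborel (conditional_density (Z (\<lambda>i. X i w)))) ((x - m \<theta>) / s \<theta>))"
    unfolding distr_Z[OF \<theta>\<^sub>0, symmetric] by (rule AE_distrD[OF Z_measurable[OF \<theta>\<^sub>0]])
  have X1: "distributed (P \<theta>\<^sub>0) lborel (X 1) (\<lambda>x. ennreal (p \<theta>\<^sub>0 x))"
    using identically_distributed[OF \<theta>\<^sub>0, of 1] sample_size by simp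
  have "AE x in density lborel (\<lambda>x. ennreal (p \<theta>\<^sub>0 x)). b x \<noteq> 0"
    using b_nonzero distributed_borel_measurable[OF X1] by (subst AE_density) auto
  then have 2: "AE w in P \<theta>\<^sub>0. b (X 1 w) \<noteq> 0"
    unfolding distributed_distr_eq_density[OF X1, symmetric]
    by (rule AE_distrD[OF distributed_measurable[OF X1]])
  from 1 2 admissible[OF \<theta>\<^sub>0] show ?thesis
    by eventually_elim (rule fiducial_is_posterior_if_regular[OF _ _ _ _ _ prior], auto)
qed

end

section \<open>Location and scale families\<close>

lemma location_is_affine_fiducial_model:
  assumes f: "probability_density f"
    and model: "fiducial_model UNIV at_bot (location_family f) n (location_ancillary n) P X K"
  shows "affine_fiducial_model UNIV at_bot (location_family f) n (location_ancillary n) P X K f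
    (\<lambda>u. u) (\<lambda>_. 1) (\<lambda>\<theta>. \<theta>) (\<lambda>_. 1) (\<lambda>_. 1) (\<lambda>k. - real k) real"
proof (intro affine_fiducial_model.intro model affine_fiducial_model_axioms.intro f)
  show "incseq (\<lambda>k. {- real k..real k})"
    by (auto simp: incseq_def)
  show "(\<Union>k. {- real k..real k}) = UNIV"
  proof -
    have "\<exists>k. - real k \<le> x \<and> x \<le> real k" for x
    proof -
      obtain k where "\<bar>x\<bar> \<le> real k" using real_arch_simple by blast
      then show ?thesis by (intro exI[of _ k]) auto
    qed
    then show ?thesis by auto
  qed
  show "filterlim (\<lambda>k. - real k) at_bot sequentially"
    by (simp add: filterlim_uminus_at_bot filterlim_real_sequentially)
  show "filterlim real at_top sequentially" by (rule filterlim_real_sequentially)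
  show "((\<lambda>\<theta>. (x - \<theta>) / 1) has_real_derivative - 1 * 1 / 1) (at \<theta>)" for \<theta> x :: real
    by (auto intro!: derivative_eq_intros)
qed (auto simp: location_family_def location_ancillary_def)

lemma scale_is_affine_fiducial_model:
  assumes f: "probability_density f"
    and model: "fiducial_model {0<..} (at_right 0) (scale_family f) n (scale_ancillary n) P X K"
  shows "affine_fiducial_model {0<..} (at_right 0) (scale_family f) n (scale_ancillary n) P X K f
    (\<lambda>_. 0) (\<lambda>u. u) (\<lambda>_. 0) (\<lambda>\<theta>. \<theta>) (\<lambda>\<theta>. 1 / \<theta>) (\<lambda>k. inverse (real (Suc k))) (\<lambda>k. real (Suc k))"
proof (intro affine_fiducial_model.intro model affine_fiducial_model_axioms.intro f)
  show "AE u in lborel. u \<noteq> (0::real)" by (rule AE_lborel_singleton)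
  show "inverse (real (Suc k)) \<le> real (Suc k)" for k
    by (rule order_trans[of _ 1]) (auto simp: inverse_le_1_iff)
  show "incseq (\<lambda>k. {inverse (real (Suc k))..real (Suc k)})"
    by (auto simp: incseq_def intro: order_trans[OF le_imp_inverse_le])
  show "(\<Union>k. {inverse (real (Suc k))..real (Suc k)}) = {0<..}"
  proof -
    have "\<exists>k. inverse (real (Suc k)) \<le> x \<and> x \<le> real (Suc k)" if "0 < x" for x
    proof -
      obtain k1 where "inverse x \<le> real k1" using real_arch_simple by blast
      moreover obtain k2 where "x \<le> real k2" using real_arch_simple by blast
      ultimately have *: "inverse x \<le> real (Suc (max k1 k2))" "x \<le> real (Suc (max k1 k2))" by auto
      from le_imp_inverse_le[OF *(1)] * that show ?thesis by auto
    qed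
    moreover have "0 < x" if "inverse (real (Suc k)) \<le> x" for k x
      using that by (rule less_le_trans[rotated]) simp
    ultimately show ?thesis by auto
  qed
  show "filterlim (\<lambda>k. inverse (real (Suc k))) (at_right 0) sequentially"
    using LIMSEQ_inverse_real_of_nat by (auto simp: filterlim_at)
  show "filterlim (\<lambda>k. real (Suc k)) at_top sequentially"
    by (rule filterlim_compose[OF filterlim_real_sequentially filterlim_Suc])
  show "((\<lambda>\<theta>. (x - 0) / \<theta>) has_real_derivative - x * (1 / \<theta>) / \<theta>) (at \<theta>)"
    if "\<theta> \<in> {0<..}" for \<theta> x :: real
    using that by (auto intro!: derivative_eq_intros simp: field_simps)
  show "continuous_on {0<..} (\<lambda>\<theta>::real. 1 / \<theta>)"
    by (intro continuous_intros) auto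
qed (simp_all add: scale_family_def scale_ancillary_def)

lemma fisher_information_location:
  "fisher_information (location_family f) \<theta> = fisher_information (location_family f) 0"
proof -
  have "deriv (\<lambda>t. ln (f (\<theta> + 1 * x - t))) \<theta> = deriv (\<lambda>t. ln (f (x - t))) 0" for x
    using DERIV_shift[of "\<lambda>t. ln (f (\<theta> + x - t))" _ 0 \<theta>]
    by (simp add: deriv_def)
  then show ?thesis
    unfolding fisher_information_def location_family_def
    by (subst lborel_integral_real_affine[where c=1 and t=\<theta>]) simp_all
qed

text \<open>Along the orbit \<open>x \<mapsto> \<theta> * x\<close> the density at parameter \<open>t\<close> is that at
  \<open>t / \<theta>\<close> divided by the constant \<open>\<theta>\<close>, so the score is the score at \<open>1\<close>
  divided by \<open>\<theta>\<close>. Where the density vanishes this can fail, because \<open>ln 0 = 0\<close>.\<close>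

lemma deriv_ln_scale_family:
  assumes \<theta>: "0 < \<theta>" and pos: "0 < f x"
    and diff: "(\<lambda>t. scale_family f t x) differentiable (at 1)"
  shows "deriv (\<lambda>t. ln (scale_family f t (\<theta> * x))) \<theta> = deriv (\<lambda>t. ln (scale_family f t x)) 1 / \<theta>"
proof -
  let ?h = "\<lambda>t. scale_family f t x"
  obtain D where D: "DERIV ?h 1 :> D"
    using diff by (auto simp: real_differentiable_def)
  have h1: "?h 1 = f x" by (simp add: scale_family_def)
  have "DERIV (\<lambda>t. ln (?h t)) 1 :> D / f x"
    using D pos by (auto intro!: derivative_eq_intros simp: h1)
  then have 1: "deriv (\<lambda>t. ln (?h t)) 1 = D / f x" by (rule DERIV_imp_deriv)
  have "scale_family f t (\<theta> * x) = ?h (t / \<theta>) / \<theta>" for t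
    using \<theta> by (simp add: scale_family_def mult.commute)
  moreover have "DERIV (\<lambda>t. ln (?h (t / \<theta>) / \<theta>)) \<theta> :> (D / f x) / \<theta>"
  proof -
    have "DERIV (\<lambda>t. ?h (t / \<theta>)) \<theta> :> D * (1 / \<theta>)"
      using \<theta> D by (intro DERIV_chain2[where f="?h"]) (auto intro!: derivative_eq_intros)
    then show ?thesis
      using \<theta> pos by (auto intro!: derivative_eq_intros simp: h1)
  qed
  ultimately have "deriv (\<lambda>t. ln (scale_family f t (\<theta> * x))) \<theta> = (D / f x) / \<theta>"
    by (simp add: DERIV_imp_deriv)
  with 1 show ?thesis by simp
qed

lemma fisher_information_scale:
  assumes f: "probability_density f" and fi: "has_fisher_information {0<..} (scale_family f)"
    and \<theta>: "0 < \<theta>"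
  shows "fisher_information (scale_family f) \<theta> = fisher_information (scale_family f) 1 / \<theta>\<^sup>2"
proof -
  have [measurable]: "f \<in> borel_measurable borel" and f0: "\<And>x. 0 \<le> f x"
    using f by (auto simp: probability_density_def)
  have p1: "scale_family f 1 = f" by (simp add: scale_family_def fun_eq_iff)
  let ?s = "\<lambda>\<theta> x. (deriv (\<lambda>t. ln (scale_family f t x)) \<theta>)\<^sup>2 * scale_family f \<theta> x"
  have int: "integrable lborel (?s \<theta>)" if "0 < \<theta>" for \<theta>
    using fi that by (simp add: has_fisher_information_def)
  have "AE x in density lborel (\<lambda>x. ennreal (scale_family f 1 x)).
      (\<lambda>t. scale_family f t x) differentiable (at 1)"
    using fi by (simp add: has_fisher_information_def)
  then have ae: "AE x in lborel. 0 < f x \<longrightarrow> (\<lambda>t. scale_family f t x) differentiable (at 1)"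
    by (simp add: p1 AE_density)
  have "fisher_information (scale_family f) \<theta> = (\<integral>x. ?s \<theta> x \<partial>lborel)"
    by (simp add: fisher_information_def)
  also have "\<dots> = \<theta> * (\<integral>x. ?s \<theta> (0 + \<theta> * x) \<partial>lborel)"
    using \<theta> by (subst lborel_integral_real_affine[where c=\<theta> and t=0]) simp_all
  also have "(\<integral>x. ?s \<theta> (0 + \<theta> * x) \<partial>lborel) = (\<integral>x. ?s 1 x / \<theta> ^ 3 \<partial>lborel)"
  proof (rule integral_cong_AE)
    show "(\<lambda>x. ?s \<theta> (0 + \<theta> * x)) \<in> borel_measurable lborel"
      using lborel_integrable_real_affine[OF int[OF \<theta>], of \<theta> 0] \<theta>
      by (intro borel_measurable_integrable) auto
    show "(\<lambda>x. ?s 1 x / \<theta> ^ 3) \<in> borel_measurable lborel"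
      using int[of 1] by (intro borel_measurable_divide borel_measurable_integrable) auto
    show "AE x in lborel. ?s \<theta> (0 + \<theta> * x) = ?s 1 x / \<theta> ^ 3"
      using ae
    proof eventually_elim
      fix x assume d: "0 < f x \<longrightarrow> (\<lambda>t. scale_family f t x) differentiable (at 1)"
      have sf: "scale_family f \<theta> (\<theta> * x) = f x / \<theta>"
        using \<theta> by (simp add: scale_family_def)
      show "?s \<theta> (0 + \<theta> * x) = ?s 1 x / \<theta> ^ 3"
      proof (cases "f x = 0")
        case False
        then have "0 < f x" using f0[of x] by simp
        with d deriv_ln_scale_family[of \<theta> f x, OF \<theta>] show ?thesis
          by (simp add: sf p1 power_divide power2_eq_square power3_eq_cube)
      qed (simp add: sf p1)
    qed
  qed
  also have "\<theta> * (\<integral>x. ?s 1 x / \<theta> ^ 3 \<partial>lborel) = fisher_information (scale_family f) 1 / \<theta>\<^sup>2"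
    using \<theta> by (simp add: fisher_information_def power2_eq_square power3_eq_cube)
  finally show ?thesis .
qed

lemma jeffreys_prior_location:
  assumes "has_fisher_information UNIV (location_family f)"
  shows "proportional_on UNIV (jeffreys_prior (location_family f)) (\<lambda>_. 1)"
proof -
  have "0 < fisher_information (location_family f) 0"
    using assms by (simp add: has_fisher_information_def)
  moreover have "jeffreys_prior (location_family f) \<theta>
      = sqrt (fisher_information (location_family f) 0) * 1" for \<theta>
    unfolding jeffreys_prior_def fisher_information_location[of f \<theta>] by simp
  ultimately show ?thesis
    unfolding proportional_on_def
    by (intro exI[of _ "sqrt (fisher_information (location_family f) 0)"]) simp
qed

lemma jeffreys_prior_scale:
  assumes f: "probability_density f" and fi: "has_fisher_information {0<..} (scale_family f)"
  shows "proportional_on {0<..} (jeffreys_prior (scale_family f)) (\<lambda>\<theta>. 1 / \<theta>)"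
proof -
  have "0 < fisher_information (scale_family f) 1"
    using fi by (simp add: has_fisher_information_def)
  moreover have "jeffreys_prior (scale_family f) \<theta>
      = sqrt (fisher_information (scale_family f) 1) * (1 / \<theta>)" if "0 < \<theta>" for \<theta>
    unfolding jeffreys_prior_def fisher_information_scale[OF f fi that]
    using that by (simp add: real_sqrt_divide)
  ultimately show ?thesis
    unfolding proportional_on_def
    by (intro exI[of _ "sqrt (fisher_information (scale_family f) 1)"]) simp
qed

theorem proposition8:
  fixes f :: "real \<Rightarrow> real"
    and n :: nat
    and X :: "nat \<Rightarrow> 'w \<Rightarrow> real"
    and P :: "real \<Rightarrow> 'w measure"
    and K :: "real \<Rightarrow> (nat \<Rightarrow> real) \<Rightarrow> real measure"
  assumes "probability_density f"
  shows
    "(fiducial_model UNIV at_bot (location_family f) n (location_ancillary n) P X K \<longrightarrow>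
       (\<forall>\<pi>. proportional_on UNIV \<pi> (\<lambda>_. 1) \<longrightarrow>
         (\<forall>\<theta>\<^sub>0. AE w in P \<theta>\<^sub>0.
           is_posterior UNIV \<pi> (location_family f) n (\<lambda>i. X i w)
             (fiducial_distribution UNIV (location_ancillary n) K (\<lambda>i. X i w)))) \<and>
       (has_fisher_information UNIV (location_family f) \<longrightarrow>
         proportional_on UNIV (jeffreys_prior (location_family f)) (\<lambda>_. 1)))
     \<and>
     (fiducial_model {0<..} (at_right 0) (scale_family f) n (scale_ancillary n) P X K \<longrightarrow>
       (\<forall>\<pi>. proportional_on {0<..} \<pi> (\<lambda>\<theta>. 1 / \<theta>) \<longrightarrow>
         (\<forall>\<theta>\<^sub>0\<in>{0<..}. AE w in P \<theta>\<^sub>0.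
           is_posterior {0<..} \<pi> (scale_family f) n (\<lambda>i. X i w)
             (fiducial_distribution {0<..} (scale_ancillary n) K (\<lambda>i. X i w)))) \<and>
       (has_fisher_information {0<..} (scale_family f) \<longrightarrow>
         proportional_on {0<..} (jeffreys_prior (scale_family f)) (\<lambda>\<theta>. 1 / \<theta>)))"
proof (intro conjI impI allI ballI)
  fix \<pi> and \<theta>\<^sub>0 :: real
  assume "fiducial_model UNIV at_bot (location_family f) n (location_ancillary n) P X K"
    and prior: "proportional_on UNIV \<pi> (\<lambda>_. 1)"
  then interpret affine_fiducial_model UNIV at_bot "location_family f" n "location_ancillary n" P X K f
      "\<lambda>u. u" "\<lambda>_. 1" "\<lambda>\<theta>. \<theta>" "\<lambda>_. 1" "\<lambda>_. 1" "\<lambda>k. - real k" real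
    by (intro location_is_affine_fiducial_model[OF assms])
  show "AE w in P \<theta>\<^sub>0. is_posterior UNIV \<pi> (location_family f) n (\<lambda>i. X i w)
      (fiducial_distribution UNIV (location_ancillary n) K (\<lambda>i. X i w))"
    by (rule fiducial_is_posterior_AE[OF UNIV_I prior])
next
  fix \<pi> and \<theta>\<^sub>0 :: real
  assume "fiducial_model {0<..} (at_right 0) (scale_family f) n (scale_ancillary n) P X K"
    and prior: "proportional_on {0<..} \<pi> (\<lambda>\<theta>. 1 / \<theta>)" and \<theta>\<^sub>0: "\<theta>\<^sub>0 \<in> {0<..}"
  then interpret affine_fiducial_model "{0<..}" "at_right 0" "scale_family f" n "scale_ancillary n" P X K f
      "\<lambda>_. 0" "\<lambda>u. u" "\<lambda>_. 0" "\<lambda>\<theta>. \<theta>" "\<lambda>\<theta>. 1 / \<theta>" "\<lambda>k. inverse (real (Suc k))" "\<lambda>k. real (Suc k)"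
    by (intro scale_is_affine_fiducial_model[OF assms])
  show "AE w in P \<theta>\<^sub>0. is_posterior {0<..} \<pi> (scale_family f) n (\<lambda>i. X i w)
      (fiducial_distribution {0<..} (scale_ancillary n) K (\<lambda>i. X i w))"
    by (rule fiducial_is_posterior_AE[OF \<theta>\<^sub>0 prior])
qed (simp_all add: jeffreys_prior_location jeffreys_prior_scale[OF assms])

end
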